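(* Let $F$ and $F^{-1}$ be the transforms defined in the context by $$F[\phi](\lambda)=\begin{cases}\int_0^1e^{-i\lambda y}\phi(y)\,dy&\lambda\in\mathbb R,\\ -\zeta^+(\lambda;\phi)/\Delta(\lambda)&\lambda\in\partial D_\rho^+,\\ -e^{-i\lambda}\zeta^-(\lambda;\phi)/\Delta(\lambda)&\lambda\in\partial D_\rho^-,\end{cases}\qquad F^{-1}[f](x)=\frac1{2\pi}\int_{\mathbb R\cup\partial D_\rho^+\cup\partial D_\rho^-}e^{i\lambda x}f(\lambda)\,d\lambda .$$ Then $F$ and $F^{-1}$ are both linear and, for all sufficiently smooth $\phi$ (namely $\phi\in C^1[0,1]$) and all $x\in(0,1)$, $F^{-1}[F[\phi]](x)=\phi(x)$.
   Context: $K:[0,1]\to\mathbb R$ is a fixed function which is supported in a neighbourhood of $0$, meaning that there is $\delta>0$ with $K(y)\neq0$ for all $y\in[0,\delta)$, and globally sufficiently smooth, meaning $K\in C^1[0,1]$. Define, for $\lambda\in\mathbb C$ and continuous $\phi:[0,1]\to\mathbb C$, $$\Delta(\lambda)=\int_0^1K(y)\cos([1-y]\lambda)\,dy,$$ $$\zeta^+(\lambda;\phi)=\int_0^1K(y)\cos([1-y]\lambda)\int_0^ye^{-i\lambda z}\phi(z)\,dz\,dy+\int_0^1K(y)e^{-i\lambda y}\int_y^1\cos([1-z]\lambda)\phi(z)\,dz\,dy,$$ $$\zeta^-(\lambda;\phi)=i\int_0^1K(y)\int_y^1\sin([z-y]\lambda)\phi(z)\,dz\,dy.$$ Let $\mathbb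 C^\pm$ be the open upper/lower half plane, let $\rho>0$ be so large that every zero $\lambda$ of $\Delta$ satisfies $|\operatorname{Im}\lambda|<\rho/\sqrt2$ (such $\rho$ exists), and let $D_\rho^\pm=\{\lambda\in\mathbb C^\pm:\operatorname{Re}(\lambda^2)<0,\ |\lambda|>\rho\}$. The contour $\partial D_\rho^\pm$ is the boundary of $D_\rho^\pm$, positively oriented (the region lies to the left); $\mathbb R$ is oriented in the increasing sense. $F[\phi]$ is the function on $\mathbb R\cup\partial D_\rho^+\cup\partial D_\rho^-$ (three disjoint contours) given by the displayed formula in the claim, and $F^{-1}[f](x)$ is $\frac1{2\pi}$ times the sum of the integrals of $e^{i\lambda x}f(\lambda)$ over the three contours, each integral over an unbounded contour being improper, understood as the limit as $N\to\infty$ of the integral over the part of the contour with $|\lambda|\leq N$. Linearity of $F^{-1}$ is meant on functions $f$ for which these limits exist. *)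

theory Defs
  imports "HOL-Complex_Analysis.Complex_Analysis"
begin

text \<open>
  Continuously differentiable on the closed unit interval, with one-sided derivatives at the
  endpoints. The library's \<open>C1_differentiable_on\<close> asks for two-sided derivatives at 0 and 1 and
  would therefore constrain values outside the interval.
\<close>
definition C1_unit :: "(real \<Rightarrow> 'a::real_normed_vector) \<Rightarrow> bool" where
  "C1_unit f \<longleftrightarrow> (\<exists>f'. continuous_on {0..1} f' \<and>
     (\<forall>x\<in>{0..1}. (f has_vector_derivative f' x) (at x within {0..1})))"

definition Delta :: "(real \<Rightarrow> real) \<Rightarrow> complex \<Rightarrow> complex" where
  "Delta K w = integral {0..1} (\<lambda>y. of_real (K y) * cos (of_real (1 - y) * w))"

definition zeta_plus :: "(real \<Rightarrow> real) \<Rightarrow> (real \<Rightarrow> complex) \<Rightarrow> complex \<Rightarrow> complex" where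
  "zeta_plus K \<phi> w =
     integral {0..1} (\<lambda>y. of_real (K y) * cos (of_real (1 - y) * w) *
       integral {0..y} (\<lambda>z. exp (- \<i> * w * of_real z) * \<phi> z)) +
     integral {0..1} (\<lambda>y. of_real (K y) * exp (- \<i> * w * of_real y) *
       integral {y..1} (\<lambda>z. cos (of_real (1 - z) * w) * \<phi> z))"

definition zeta_minus :: "(real \<Rightarrow> real) \<Rightarrow> (real \<Rightarrow> complex) \<Rightarrow> complex \<Rightarrow> complex" where
  "zeta_minus K \<phi> w =
     \<i> * integral {0..1} (\<lambda>y. of_real (K y) *
       integral {y..1} (\<lambda>z. sin (of_real (z - y) * w) * \<phi> z))"

definition D_plus :: "real \<Rightarrow> complex set" where
  "D_plus \<rho> = {w. Im w > 0 \<and> Re (w\<^sup>2) < 0 \<and> cmod w > \<rho>}"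

definition D_minus :: "real \<Rightarrow> complex set" where
  "D_minus \<rho> = {w. Im w < 0 \<and> Re (w\<^sup>2) < 0 \<and> cmod w > \<rho>}"

definition contours :: "real \<Rightarrow> complex set" where
  "contours \<rho> = \<real> \<union> frontier (D_plus \<rho>) \<union> frontier (D_minus \<rho>)"

text \<open>
  The value 0 off the three contours is a dummy: the transform is a function on \<open>contours \<rho>\<close> only.
\<close>
definition F_transform ::
  "(real \<Rightarrow> real) \<Rightarrow> real \<Rightarrow> (real \<Rightarrow> complex) \<Rightarrow> complex \<Rightarrow> complex" where
  "F_transform K \<rho> \<phi> w =
     (if w \<in> \<real> then integral {0..1} (\<lambda>y. exp (- \<i> * w * of_real y) * \<phi> y)
      else if w \<in> frontier (D_plus \<rho>) then - zeta_plus K \<phi> w / Delta K w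
      else if w \<in> frontier (D_minus \<rho>) then - exp (- \<i> * w) * zeta_minus K \<phi> w / Delta K w
      else 0)"

text \<open>
  For \<open>N \<ge> \<rho>\<close> the following paths trace the parts of the three contours with modulus at most \<open>N\<close>.
  \<open>D_plus \<rho>\<close> is the part of the sector \<open>pi/4 < arg < 3 pi/4\<close> outside the disc of radius \<open>\<rho>\<close>.
  Keeping it on the left means coming in along the ray \<open>3 pi/4\<close>, going clockwise along the
  circle, and going out along the ray \<open>pi/4\<close>. The path for \<open>D_minus \<rho>\<close> is its rotation by \<open>pi\<close>.
\<close>
definition real_path :: "real \<Rightarrow> real \<Rightarrow> complex" where
  "real_path N = linepath (- of_real N) (of_real N)"

definition plus_path :: "real \<Rightarrow> real \<Rightarrow> real \<Rightarrow> complex" where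
  "plus_path \<rho> N =
     linepath (of_real N * cis (3 * pi / 4)) (of_real \<rho> * cis (3 * pi / 4)) +++
     part_circlepath 0 \<rho> (3 * pi / 4) (pi / 4) +++
     linepath (of_real \<rho> * cis (pi / 4)) (of_real N * cis (pi / 4))"

definition minus_path :: "real \<Rightarrow> real \<Rightarrow> real \<Rightarrow> complex" where
  "minus_path \<rho> N =
     linepath (of_real N * cis (- pi / 4)) (of_real \<rho> * cis (- pi / 4)) +++
     part_circlepath 0 \<rho> (- pi / 4) (- 3 * pi / 4) +++
     linepath (of_real \<rho> * cis (- 3 * pi / 4)) (of_real N * cis (- 3 * pi / 4))"

definition improper_integrable :: "(real \<Rightarrow> real \<Rightarrow> complex) \<Rightarrow> (complex \<Rightarrow> complex) \<Rightarrow> bool" where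
  "improper_integrable \<gamma> g \<longleftrightarrow> (\<forall>\<^sub>F N in at_top. g contour_integrable_on \<gamma> N) \<and>
     (\<exists>I. ((\<lambda>N. contour_integral (\<gamma> N) g) \<longlongrightarrow> I) at_top)"

definition improper_integral :: "(real \<Rightarrow> real \<Rightarrow> complex) \<Rightarrow> (complex \<Rightarrow> complex) \<Rightarrow> complex" where
  "improper_integral \<gamma> g = Lim at_top (\<lambda>N. contour_integral (\<gamma> N) g)"

definition Finv_exists :: "real \<Rightarrow> (complex \<Rightarrow> complex) \<Rightarrow> real \<Rightarrow> bool" where
  "Finv_exists \<rho> f x \<longleftrightarrow>
     (\<forall>\<gamma> \<in> {real_path, plus_path \<rho>, minus_path \<rho>}.
        improper_integrable \<gamma> (\<lambda>w. exp (\<i> * w * of_real x) * f w))"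

text \<open>Meaningful only when \<open>Finv_exists \<rho> f x\<close>.\<close>
definition F_inverse :: "real \<Rightarrow> (complex \<Rightarrow> complex) \<Rightarrow> real \<Rightarrow> complex" where
  "F_inverse \<rho> f x = 1 / (2 * of_real pi) *
     (improper_integral real_path (\<lambda>w. exp (\<i> * w * of_real x) * f w) +
      improper_integral (plus_path \<rho>) (\<lambda>w. exp (\<i> * w * of_real x) * f w) +
      improper_integral (minus_path \<rho>) (\<lambda>w. exp (\<i> * w * of_real x) * f w))"

end

theory Submission
  imports Defs "HOL-Probability.Sinc_Integral" "HOL-Real_Asymp.Real_Asymp"
begin

text \<open>
  The real line already contributes everything: by Fourier inversion, the improper integral of
  \<open>exp (\<i> * w * x)\<close> times the Fourier transform of \<open>\<phi>\<close> over the real line is \<open>2 * pi * \<phi> x\<close> at an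
  interior point. What has to be shown is that the two sector contours contribute nothing.

  On the upper contour the integrand is \<open>exp (\<i> * w * x) * zeta_plus K \<phi> w / Delta K w\<close> up to sign.
  Here \<open>zeta_plus K \<phi> w\<close> is at most a constant times \<open>exp \<bar>Im w\<bar>\<close>: in each of its terms the growth
  rates of the two factors add up to at most 1. An integration by parts shows that \<open>w * Delta K w\<close> is
  \<open>K 0 * sin w\<close> plus a term smaller by a factor of order \<open>1 / \<bar>Im w\<bar>\<close>, and \<open>K 0\<close> is nonzero, so it is at
  least a constant times \<open>exp \<bar>Im w\<bar>\<close> once \<open>\<bar>Im w\<bar>\<close> is large. Their quotient is therefore at most of
  the order of \<open>cmod w\<close>, and for \<open>x > 0\<close> the factor \<open>exp (\<i> * w * x)\<close>, of modulus
  \<open>exp (- x * Im w)\<close>, makes the integrand decay exponentially inside the sector, where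
  \<open>cmod w \<le> sqrt 2 * Im w\<close>. On the lower contour the quotient of \<open>zeta_minus\<close> and \<open>Delta\<close> obeys the same
  bound, and there it is \<open>exp (\<i> * w * (x - 1))\<close> that decays, because \<open>x < 1\<close>.

  The whole truncated contour lies in the half plane \<open>Im w \<ge> \<rho> / sqrt 2\<close>, which is convex and free of
  zeros of \<open>Delta K\<close>. Cauchy's theorem for convex sets thus replaces it by the horizontal segment joining
  its end points, at height \<open>N / sqrt 2\<close>, where the integrand is exponentially small
  (\<open>plus_path_integral_vanishes\<close>). The lower contour is the upper one under \<open>w \<mapsto> - w\<close>.

  The Fourier inversion (\<open>real_line_inversion\<close>) uses that \<open>\<phi>\<close> is continuously differentiable.
  Fubini turns the truncated integral into an integral against the Dirichlet kernel, whose primitive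
  is the sine integral \<open>Si\<close>; after integration by parts the kernel has become the bounded function
  \<open>Si (N * (x - y))\<close>, and dominated convergence applies with limit \<open>pi / 2 * sgn (x - y)\<close>.
\<close>

section \<open>Integrals depending holomorphically on a parameter\<close>

text \<open>
  Besides holomorphy in \<open>w\<close>, the joint continuity of the function and of its \<open>w\<close>-derivative is
  part of the notion: this is what differentiation under the integral sign asks for, and it makes the
  class closed under integration in \<open>y\<close>, so that it covers the iterated integrals in \<open>zeta_plus\<close>
  and \<open>zeta_minus\<close>.
\<close>
definition entire_family :: "(complex \<Rightarrow> real \<Rightarrow> complex) \<Rightarrow> bool" where
  "entire_family f \<longleftrightarrow> (\<exists>f'.
     continuous_on (UNIV \<times> {0..1}) (\<lambda>(w, y). f w y) \<and>
     continuous_on (UNIV \<times> {0..1}) (\<lambda>(w, y). f' w y) \<and>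
     (\<forall>w. \<forall>y\<in>{0..1}. ((\<lambda>w. f w y) has_field_derivative f' w y) (at w)))"

lemma entire_familyI:
  assumes "continuous_on (UNIV \<times> {0..1}) (\<lambda>p. f (fst p) (snd p))"
    and "continuous_on (UNIV \<times> {0..1}) (\<lambda>p. f' (fst p) (snd p))"
    and "\<And>w y. y \<in> {0..1} \<Longrightarrow> ((\<lambda>w. f w y) has_field_derivative f' w y) (at w)"
  shows "entire_family f"
  using assms unfolding entire_family_def case_prod_unfold by blast

lemma entire_familyE:
  assumes "entire_family f"
  obtains f' where "continuous_on (UNIV \<times> {0..1}) (\<lambda>p. f (fst p) (snd p))"
    "continuous_on (UNIV \<times> {0..1}) (\<lambda>p. f' (fst p) (snd p))"
    "\<And>w y. y \<in> {0..1} \<Longrightarrow> ((\<lambda>w. f w y) has_field_derivative f' w y) (at w)"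
  using assms unfolding entire_family_def case_prod_unfold by blast

lemma entire_family_continuous_on:
  assumes "entire_family f"
  shows "continuous_on {0..1} (f w)"
proof -
  obtain f' where "continuous_on (UNIV \<times> {0..1}) (\<lambda>p. f (fst p) (snd p))"
    using assms by (rule entire_familyE)
  from continuous_on_compose2[OF this, of "{0..1}" "\<lambda>y. (w, y)"] show ?thesis
    by (force intro: continuous_intros)
qed

lemma entire_family_cong:
  assumes "\<And>w y. y \<in> {0..1} \<Longrightarrow> f w y = g w y" and "entire_family g"
  shows "entire_family f"
proof -
  obtain g' where g: "continuous_on (UNIV \<times> {0..1}) (\<lambda>p. g (fst p) (snd p))"
    "continuous_on (UNIV \<times> {0..1}) (\<lambda>p. g' (fst p) (snd p))"
    "\<And>w y. y \<in> {0..1} \<Longrightarrow> ((\<lambda>w. g w y) has_field_derivative g' w y) (at w)"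
    using entire_familyE[OF assms(2)] by metis
  show ?thesis
  proof (rule entire_familyI[where f' = g'])
    show "continuous_on (UNIV \<times> {0..1}) (\<lambda>p. f (fst p) (snd p))"
      using g(1) by (rule continuous_on_eq) (auto simp: assms(1))
  qed (use g assms(1) in auto)
qed

lemma entire_family_const:
  assumes "continuous_on {0..1} g"
  shows "entire_family (\<lambda>w y. g y)"
  by (rule entire_familyI[where f' = "\<lambda>_ _. 0"])
    (auto intro!: continuous_on_compose2[OF assms] continuous_intros)

lemma entire_family_id: "entire_family (\<lambda>w y. w)"
  by (rule entire_familyI[where f' = "\<lambda>_ _. 1"]) (auto intro!: continuous_intros)

lemma entire_family_add:
  assumes "entire_family f" "entire_family g"
  shows "entire_family (\<lambda>w y. f w y + g w y)"
proof -
  obtain f' where f: "continuous_on (UNIV \<times> {0..1}) (\<lambda>p. f (fst p) (snd p))"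
    "continuous_on (UNIV \<times> {0..1}) (\<lambda>p. f' (fst p) (snd p))"
    "\<And>w y. y \<in> {0..1} \<Longrightarrow> ((\<lambda>w. f w y) has_field_derivative f' w y) (at w)"
    using entire_familyE[OF assms(1)] by metis
  obtain g' where g: "continuous_on (UNIV \<times> {0..1}) (\<lambda>p. g (fst p) (snd p))"
    "continuous_on (UNIV \<times> {0..1}) (\<lambda>p. g' (fst p) (snd p))"
    "\<And>w y. y \<in> {0..1} \<Longrightarrow> ((\<lambda>w. g w y) has_field_derivative g' w y) (at w)"
    using entire_familyE[OF assms(2)] by metis
  show ?thesis
    by (rule entire_familyI[where f' = "\<lambda>w y. f' w y + g' w y"])
      (intro continuous_intros derivative_intros f g | assumption)+
qed

lemma entire_family_mult:
  assumes "entire_family f" "entire_family g"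
  shows "entire_family (\<lambda>w y. f w y * g w y)"
proof -
  obtain f' where f: "continuous_on (UNIV \<times> {0..1}) (\<lambda>p. f (fst p) (snd p))"
    "continuous_on (UNIV \<times> {0..1}) (\<lambda>p. f' (fst p) (snd p))"
    "\<And>w y. y \<in> {0..1} \<Longrightarrow> ((\<lambda>w. f w y) has_field_derivative f' w y) (at w)"
    using entire_familyE[OF assms(1)] by metis
  obtain g' where g: "continuous_on (UNIV \<times> {0..1}) (\<lambda>p. g (fst p) (snd p))"
    "continuous_on (UNIV \<times> {0..1}) (\<lambda>p. g' (fst p) (snd p))"
    "\<And>w y. y \<in> {0..1} \<Longrightarrow> ((\<lambda>w. g w y) has_field_derivative g' w y) (at w)"
    using entire_familyE[OF assms(2)] by metis
  show ?thesis
    by (rule entire_familyI[where f' = "\<lambda>w y. f' w y * g w y + g' w y * f w y"])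
      (intro continuous_intros DERIV_mult f g | assumption)+
qed

lemma entire_family_compose:
  assumes "entire_family f"
    and h: "\<And>z. (h has_field_derivative h' z) (at z)" "continuous_on UNIV h'"
  shows "entire_family (\<lambda>w y. h (f w y))"
proof -
  obtain f' where f: "continuous_on (UNIV \<times> {0..1}) (\<lambda>p. f (fst p) (snd p))"
    "continuous_on (UNIV \<times> {0..1}) (\<lambda>p. f' (fst p) (snd p))"
    "\<And>w y. y \<in> {0..1} \<Longrightarrow> ((\<lambda>w. f w y) has_field_derivative f' w y) (at w)"
    using entire_familyE[OF assms(1)] by metis
  have "continuous_on UNIV h"
    using h(1) by (meson DERIV_isCont continuous_at_imp_continuous_on)
  then show ?thesis
    by (intro entire_familyI[where f' = "\<lambda>w y. h' (f w y) * f' w y"])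
      (auto intro!: continuous_on_compose2[OF _ f(1)] continuous_on_compose2[OF h(2) f(1)]
        continuous_intros f(2) DERIV_chain2[OF h(1) f(3)])
qed

lemmas entire_family_exp = entire_family_compose[of _ exp exp, OF _ DERIV_exp continuous_on_exp[OF continuous_on_id]]
lemmas entire_family_sin = entire_family_compose[of _ sin cos, OF _ DERIV_sin continuous_on_cos[OF continuous_on_id]]

lemma entire_family_cos: "entire_family f \<Longrightarrow> entire_family (\<lambda>w y. cos (f w y))"
  by (rule entire_family_compose[of _ cos "\<lambda>z. - sin z"]) (auto intro!: continuous_intros)

text \<open>
  The substitution \<open>z = y * t\<close> moves the variable endpoint into the integrand, where the theorems on
  parameter integrals over a fixed interval can treat it as a parameter.
\<close>
lemma integral_scale_to_unit:
  fixes g :: "real \<Rightarrow> complex"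
  assumes "y \<ge> 0"
  shows "integral {0..y} g = of_real y * integral {0..1} (\<lambda>t. g (y * t))"
proof (cases "y = 0")
  case False
  have "(\<lambda>x. x / y) ` {0..y} = {0..1}"
    using assms False by (subst image_divide_atLeastAtMost) auto
  then show ?thesis
    using integral_stretch_real[of y 0 y g] assms False by (simp add: scaleR_conv_of_real)
qed auto

lemma continuous_on_integral_upto:
  fixes f :: "complex \<Rightarrow> real \<Rightarrow> complex"
  assumes "continuous_on (UNIV \<times> {0..1}) (\<lambda>p. f (fst p) (snd p))"
  shows "continuous_on (UNIV \<times> {0..1}) (\<lambda>p. integral {0..snd p} (f (fst p)))"
proof -
  have "continuous_on ((UNIV \<times> {0..1}) \<times> cbox 0 1)
      (\<lambda>(p :: complex \<times> real, t). f (fst p) (snd p * t))"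
    unfolding case_prod_unfold
    by (rule continuous_on_compose2[OF assms, where f = "\<lambda>q. (fst (fst q), snd (fst q) * snd q)", simplified])
      (auto intro!: continuous_intros mult_le_one)
  from integral_continuous_on_param[OF this]
  have "continuous_on (UNIV \<times> {0..1}) (\<lambda>p. of_real (snd p) * integral {0..1} (\<lambda>t. f (fst p) (snd p * t)))"
    by (auto intro!: continuous_intros)
  then show ?thesis
    by (rule continuous_on_eq) (auto simp: integral_scale_to_unit[symmetric])
qed

lemma entire_family_integral_upto:
  assumes "entire_family f"
  shows "entire_family (\<lambda>w y. integral {0..y} (f w))"
proof -
  obtain f' where f: "continuous_on (UNIV \<times> {0..1}) (\<lambda>p. f (fst p) (snd p))"
    "continuous_on (UNIV \<times> {0..1}) (\<lambda>p. f' (fst p) (snd p))"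
    "\<And>w y. y \<in> {0..1} \<Longrightarrow> ((\<lambda>w. f w y) has_field_derivative f' w y) (at w)"
    using entire_familyE[OF assms(1)] by metis
  show ?thesis
  proof (rule entire_familyI[where f' = "\<lambda>w y. integral {0..y} (f' w)"])
    fix w :: complex and y :: real assume y: "y \<in> {0..1}"
    have "((\<lambda>w. integral (cbox 0 y) (f w)) has_field_derivative integral (cbox 0 y) (f' w)) (at w within UNIV)"
    proof (rule leibniz_rule_field_derivative)
      show "f v integrable_on cbox 0 y" for v
        using entire_family_continuous_on[OF assms, of v] y
        by (auto intro!: integrable_continuous_interval elim: continuous_on_subset)
      show "continuous_on (UNIV \<times> cbox 0 y) (\<lambda>(x, t). f' x t)"
        unfolding case_prod_unfold
        by (rule continuous_on_subset[OF f(2)]) (use y in auto)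
    qed (use f(3) y in auto)
    then show "((\<lambda>w. integral {0..y} (f w)) has_field_derivative integral {0..y} (f' w)) (at w)"
      by simp
  qed (use f in \<open>auto intro: continuous_on_integral_upto\<close>)
qed

text \<open>
  An integral from \<open>y\<close> to \<open>1\<close> is the integral over the whole interval minus the one up to \<open>y\<close>.
\<close>
lemma entire_family_integral_from:
  assumes "entire_family f"
  shows "entire_family (\<lambda>w y. integral {y..1} (f w))"
proof -
  have full: "entire_family (\<lambda>w y. integral {0..1} (f w))"
  proof -
    obtain f' where f: "continuous_on (UNIV \<times> {0..1}) (\<lambda>p. integral {0..snd p} (f (fst p)))"
      "continuous_on (UNIV \<times> {0..1}) (\<lambda>p. f' (fst p) (snd p))"
      "\<And>w y. y \<in> {0..1} \<Longrightarrow> ((\<lambda>w. integral {0..y} (f w)) has_field_derivative f' w y) (at w)"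
      using entire_familyE[OF entire_family_integral_upto[OF assms]] by metis
    show ?thesis
      by (rule entire_familyI[where f' = "\<lambda>w _. f' w 1"])
        (use f(3) in \<open>auto intro!: continuous_intros continuous_on_compose2[OF f(1), where f = "\<lambda>q. (fst q, 1)", simplified]
          continuous_on_compose2[OF f(2), where f = "\<lambda>q. (fst q, 1)", simplified]\<close>)
  qed
  have "entire_family (\<lambda>w y. integral {0..1} (f w) + (-1) * integral {0..y} (f w))"
    by (intro entire_family_add full entire_family_mult entire_family_const
        entire_family_integral_upto assms continuous_intros)
  moreover have "integral {y..1} (f w) = integral {0..1} (f w) + (-1) * integral {0..y} (f w)"
    if "y \<in> {0..1}" for w y
  proof -
    have "f w integrable_on {0..1}"
      by (intro integrable_continuous_interval entire_family_continuous_on assms)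
    with that show ?thesis
      using Henstock_Kurzweil_Integration.integral_combine[of 0 y 1 "f w"] by (simp add: algebra_simps)
  qed
  ultimately show ?thesis
    by (rule entire_family_cong[rotated])
qed

lemma entire_family_integral_holomorphic:
  assumes "entire_family f"
  shows "(\<lambda>w. integral {0..1} (f w)) holomorphic_on S"
proof -
  obtain f' where 
    "\<And>w y. y \<in> {0..1} \<Longrightarrow> ((\<lambda>w. integral {0..y} (f w)) has_field_derivative f' w y) (at w)"
    using entire_familyE[OF entire_family_integral_upto[OF assms]] by metis
  then have "((\<lambda>w. integral {0..1} (f w)) has_field_derivative f' w 1) (at w)" for w
    by simp
  then show ?thesis
    by (meson field_differentiable_at_within field_differentiable_def holomorphic_onI)
qed

section \<open>Holomorphy and exponential growth of the transform data\<close>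

lemma norm_exp_i_le:
  fixes w :: complex
  shows "norm (exp (\<i> * w)) \<le> exp \<bar>Im w\<bar>" "norm (exp (- (\<i> * w))) \<le> exp \<bar>Im w\<bar>"
  by simp_all

lemma norm_cos_le_exp_Im: "norm (cos w) \<le> exp \<bar>Im w\<bar>" for w :: complex
proof -
  have "norm (cos w) \<le> (norm (exp (\<i> * w)) + norm (exp (- (\<i> * w)))) / 2"
    unfolding cos_exp_eq using norm_triangle_ineq[of "exp (\<i> * w)" "exp (- (\<i> * w))"]
    by (simp add: norm_divide)
  then show ?thesis
    using norm_exp_i_le[of w] by argo
qed

lemma norm_sin_le_exp_Im: "norm (sin w) \<le> exp \<bar>Im w\<bar>" for w :: complex
proof -
  have "norm (sin w) \<le> (norm (exp (\<i> * w)) + norm (exp (- (\<i> * w)))) / 2"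
    unfolding sin_exp_eq using norm_triangle_ineq4[of "exp (\<i> * w)" "exp (- (\<i> * w))"]
    by (simp add: norm_divide norm_mult)
  then show ?thesis
    using norm_exp_i_le[of w] by argo
qed

text \<open>
  The two exponentials in \<open>sin w\<close> have moduli \<open>exp (Im w)\<close> and \<open>exp (- Im w)\<close>; away from the real
  line one of them dominates.
\<close>
lemma norm_sin_ge_exp_Im:
  fixes w :: complex
  assumes "\<bar>Im w\<bar> \<ge> 1"
  shows "exp \<bar>Im w\<bar> / 4 \<le> norm (sin w)"
proof -
  have "norm (sin w) = norm (exp (\<i> * w) - exp (- (\<i> * w))) / 2"
    unfolding sin_exp_eq by (simp add: norm_divide norm_mult)
  moreover have "norm (exp (\<i> * w) - exp (- (\<i> * w))) \<ge> \<bar>exp (- Im w) - exp (Im w)\<bar>"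
    using norm_triangle_ineq3[of "exp (\<i> * w)" "exp (- (\<i> * w))"] by simp
  moreover have "\<bar>exp (- Im w) - exp (Im w)\<bar> \<ge> exp \<bar>Im w\<bar> / 2"
  proof -
    define t where "t = \<bar>Im w\<bar>"
    have "exp (- t) \<le> 1" "exp t \<ge> 2"
      using assms exp_ge_add_one_self[of t] unfolding t_def[symmetric] by (simp, linarith)
    moreover have "\<bar>exp (- Im w) - exp (Im w)\<bar> = \<bar>exp (- t) - exp t\<bar>"
      by (auto simp: t_def abs_if)
    ultimately show ?thesis
      unfolding t_def[symmetric] by linarith
  qed
  ultimately show ?thesis by linarith
qed

lemma C1_unit_continuous_on: "C1_unit f \<Longrightarrow> continuous_on {0..1} f"
  unfolding C1_unit_def by (meson continuous_on_vector_derivative)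

lemma continuous_on_unit_bounded:
  fixes f :: "real \<Rightarrow> 'a::real_normed_vector"
  assumes "continuous_on {0..1} f"
  obtains B where "B \<ge> 0" "\<And>y. y \<in> {0..1} \<Longrightarrow> norm (f y) \<le> B"
proof -
  have "bounded (f ` {0..1})"
    by (intro compact_imp_bounded compact_continuous_image assms compact_Icc)
  then obtain B where "\<forall>x\<in>f ` {0..1}. norm x \<le> B"
    unfolding bounded_iff by blast
  then show ?thesis
    by (intro that[of "\<bar>B\<bar>"]) force+
qed

text \<open>
  One integration by parts, which isolates the boundary term at \<open>0\<close>. The boundary term at \<open>1\<close>
  vanishes with the sine.
\<close>
lemma Delta_times_arg:
  assumes K': "continuous_on {0..1} K'"
    "\<And>y. y \<in> {0..1} \<Longrightarrow> (K has_vector_derivative K' y) (at y within {0..1})"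
  shows "w * Delta K w = of_real (K 0) * sin w +
    integral {0..1} (\<lambda>y. of_real (K' y) * sin (of_real (1 - y) * w))"
proof -
  define f where "f y = of_real (K y) * sin (of_real (1 - y) * w)" for y
  have K: "continuous_on {0..1} K"
    using K' by (meson continuous_on_vector_derivative)
  have deriv: "(f has_vector_derivative of_real (K' y) * sin (of_real (1 - y) * w)
      - w * (of_real (K y) * cos (of_real (1 - y) * w))) (at y within {0..1})" if "y \<in> {0..1}" for y
  proof -
    have s: "((\<lambda>y. sin (of_real (1 - y) * w)) has_vector_derivative - w * cos (of_real (1 - y) * w))
        (at y within {0..1})"
    proof -
      have "((\<lambda>z. sin ((1 - z) * w)) has_field_derivative - w * cos ((1 - of_real y) * w)) (at (of_real y))"
        by (auto intro!: derivative_eq_intros)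
      from has_vector_derivative_real_field[OF this] show ?thesis by simp
    qed
    have "((\<lambda>y. of_real (K y) :: complex) has_vector_derivative of_real (K' y)) (at y within {0..1})"
      using K'(2)[OF that] by (intro has_vector_derivative_of_real)
        (simp add: has_real_derivative_iff_has_vector_derivative)
    from has_vector_derivative_mult[OF this s] show ?thesis
      unfolding f_def by (simp add: algebra_simps)
  qed
  have "((\<lambda>y. of_real (K' y) * sin (of_real (1 - y) * w)
      - w * (of_real (K y) * cos (of_real (1 - y) * w))) has_integral f 1 - f 0) {0..1}"
    by (rule Henstock_Kurzweil_Integration.fundamental_theorem_of_calculus) (use deriv in auto)
  then have "f 1 - f 0 = integral {0..1} (\<lambda>y. of_real (K' y) * sin (of_real (1 - y) * w)
      - w * (of_real (K y) * cos (of_real (1 - y) * w)))"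
    by (simp add: integral_unique)
  also have "\<dots> = integral {0..1} (\<lambda>y. of_real (K' y) * sin (of_real (1 - y) * w))
      - integral {0..1} (\<lambda>y. w * (of_real (K y) * cos (of_real (1 - y) * w)))"
    by (intro integral_diff integrable_continuous_interval continuous_intros K K')
  finally show ?thesis
    by (simp add: f_def Delta_def algebra_simps)
qed

text \<open>
  In \<open>Delta_times_arg\<close> the boundary term has size at least \<open>\<bar>K 0\<bar> / 4 * exp \<bar>Im w\<bar>\<close> when
  \<open>\<bar>Im w\<bar> \<ge> 1\<close>, whereas the
  remaining integral gains a factor \<open>1 / \<bar>Im w\<bar>\<close> from \<open>\<integral> exp ((1 - y) * \<bar>Im w\<bar>) dy\<close>.
\<close>
lemma Delta_lower_bound:
  assumes "C1_unit K" "K 0 \<noteq> 0"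
  obtains k R where "k > 0" "R \<ge> 1"
    "\<And>w. \<bar>Im w\<bar> \<ge> R \<Longrightarrow> k * exp \<bar>Im w\<bar> \<le> norm (w * Delta K w)"
proof -
  obtain K' where K': "continuous_on {0..1} K'"
    "\<And>y. y \<in> {0..1} \<Longrightarrow> (K has_vector_derivative K' y) (at y within {0..1})"
    using assms(1) unfolding C1_unit_def by blast
  obtain M where M: "M \<ge> 0" "\<And>y. y \<in> {0..1} \<Longrightarrow> norm (K' y) \<le> M"
    using continuous_on_unit_bounded[OF K'(1)] by blast
  \<comment> \<open>half of the constant in the lower bound for the boundary term; the other half absorbs the integral\<close>
  define k where "k = \<bar>K 0\<bar> / 8"
  define R where "R = max 1 (M / k)"
  have k: "k > 0" using assms(2) by (simp add: k_def)
  have "k * exp \<bar>Im w\<bar> \<le> norm (w * Delta K w)" if R: "\<bar>Im w\<bar> \<ge> R" for w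
  proof -
    define t where "t = \<bar>Im w\<bar>"
    have t: "t \<ge> 1" "M / t \<le> k"
      using R k unfolding R_def t_def by (auto simp: field_simps)
    have "norm (integral {0..1} (\<lambda>y. of_real (K' y) * sin (of_real (1 - y) * w)))
        \<le> integral {0..1} (\<lambda>y. M * exp ((1 - y) * t))"
    proof (rule integral_norm_bound_integral)
      fix y :: real assume y: "y \<in> {0..1}"
      have "norm (sin (of_real (1 - y) * w)) \<le> exp ((1 - y) * t)"
        using norm_sin_le_exp_Im[of "of_real (1 - y) * w"] y by (simp add: abs_mult t_def)
      then show "norm (of_real (K' y) * sin (of_real (1 - y) * w)) \<le> M * exp ((1 - y) * t)"
        using M y unfolding norm_mult by (intro mult_mono) auto
    qed (intro integrable_continuous_interval continuous_intros K')+
    also have "\<dots> = M * (exp t - 1) / t"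
    proof -
      have "((\<lambda>y. M * exp ((1 - y) * t)) has_integral
          (- M * exp ((1 - 1) * t) / t) - (- M * exp ((1 - 0) * t) / t)) {0..1}"
        using t by (intro Henstock_Kurzweil_Integration.fundamental_theorem_of_calculus)
          (auto intro!: derivative_eq_intros simp: has_real_derivative_iff_has_vector_derivative[symmetric])
      from integral_unique[OF this] show ?thesis
        using t by (simp only:) (simp add: field_simps)
    qed
    also have "\<dots> \<le> M / t * exp t"
      using M t by (simp add: field_simps)
    also have "\<dots> \<le> k * exp t"
      using t by (intro mult_right_mono) auto
    finally have I: "norm (integral {0..1} (\<lambda>y. of_real (K' y) * sin (of_real (1 - y) * w))) \<le> k * exp t" .
    have "norm (of_real (K 0) * sin w) \<ge> \<bar>K 0\<bar> * (exp t / 4)"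
      unfolding norm_mult norm_of_real using norm_sin_ge_exp_Im[of w] t
      by (intro mult_left_mono) (auto simp: t_def)
    then have "norm (of_real (K 0) * sin w) \<ge> 2 * k * exp t"
      by (simp add: k_def)
    moreover have "w * Delta K w = of_real (K 0) * sin w +
        integral {0..1} (\<lambda>y. of_real (K' y) * sin (of_real (1 - y) * w))"
      by (rule Delta_times_arg) (use K' in auto)
    ultimately show ?thesis
      using I norm_triangle_ineq2[of "of_real (K 0) * sin w"
          "- integral {0..1} (\<lambda>y. of_real (K' y) * sin (of_real (1 - y) * w))"]
      unfolding t_def[symmetric] diff_minus_eq_add norm_minus_cancel by simp
  qed
  with k show ?thesis by (intro that[of k R]) (auto simp: R_def)
qed

lemma entire_family_Delta:
  assumes "continuous_on {0..1} K"
  shows "entire_family (\<lambda>w y. of_real (K y) * cos (of_real (1 - y) * w))"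
  by (intro entire_family_mult entire_family_cos entire_family_id)
    (intro entire_family_const continuous_intros assms)+

lemma entire_family_zeta_plus1:
  assumes "continuous_on {0..1} K" "continuous_on {0..1} \<phi>"
  shows "entire_family (\<lambda>w y. of_real (K y) * cos (of_real (1 - y) * w) *
       integral {0..y} (\<lambda>z. exp (- \<i> * w * of_real z) * \<phi> z))"
  by (intro entire_family_mult[OF entire_family_Delta] entire_family_integral_upto assms
      entire_family_mult[OF entire_family_exp] 
      entire_family_mult[OF entire_family_mult[OF _ entire_family_id]])
    (intro entire_family_const continuous_intros assms)+

lemma entire_family_zeta_plus2:
  assumes "continuous_on {0..1} K" "continuous_on {0..1} \<phi>"
  shows "entire_family (\<lambda>w y. of_real (K y) * exp (- \<i> * w * of_real y) *
       integral {y..1} (\<lambda>z. cos (of_real (1 - z) * w) * \<phi> z))"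
  by (intro entire_family_mult[OF entire_family_mult[OF _ entire_family_exp]] entire_family_integral_from assms
      entire_family_mult[OF entire_family_cos] entire_family_mult[OF _ entire_family_id]
      entire_family_mult[OF entire_family_mult[OF _ entire_family_id]])
    (intro entire_family_const continuous_intros assms)+

text \<open>
  The kernel \<open>sin ((z - y) * w)\<close> couples the two integration variables; the addition theorem splits it
  into products of a function of \<open>y\<close> and one of \<open>z\<close>.
\<close>
lemma entire_family_zeta_minus:
  assumes "continuous_on {0..1} K" "continuous_on {0..1} \<phi>"
  shows "entire_family (\<lambda>w y. of_real (K y) *
       integral {y..1} (\<lambda>z. sin (of_real (z - y) * w) * \<phi> z))"
proof (rule entire_family_cong)
  fix w :: complex and y :: real assume y: "y \<in> {0..1}"
  have \<phi>: "continuous_on {y..1} \<phi>"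
    by (rule continuous_on_subset[OF assms(2)]) (use y in auto)
  have "integral {y..1} (\<lambda>z. sin (of_real (z - y) * w) * \<phi> z) =
      integral {y..1} (\<lambda>z. cos (of_real y * w) * (sin (of_real z * w) * \<phi> z)
        + (- sin (of_real y * w)) * (cos (of_real z * w) * \<phi> z))"
    by (intro integral_cong) (simp add: left_diff_distrib sin_diff algebra_simps)
  also have "\<dots> = cos (of_real y * w) * integral {y..1} (\<lambda>z. sin (of_real z * w) * \<phi> z)
      + (- sin (of_real y * w)) * integral {y..1} (\<lambda>z. cos (of_real z * w) * \<phi> z)"
    by (subst Henstock_Kurzweil_Integration.integral_add)
      (intro integrable_continuous_interval continuous_intros \<phi> | simp)+
  finally show "of_real (K y) * integral {y..1} (\<lambda>z. sin (of_real (z - y) * w) * \<phi> z) =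
    of_real (K y) * (cos (of_real y * w) * integral {y..1} (\<lambda>z. sin (of_real z * w) * \<phi> z)
      + ((-1) * sin (of_real y * w)) * integral {y..1} (\<lambda>z. cos (of_real z * w) * \<phi> z))" by simp
next
  have lin: "entire_family (\<lambda>w y. of_real y * w)"
    by (intro entire_family_mult entire_family_id entire_family_const continuous_intros)
  show "entire_family (\<lambda>w y. of_real (K y) * (cos (of_real y * w) * integral {y..1} (\<lambda>z. sin (of_real z * w) * \<phi> z)
      + ((-1) * sin (of_real y * w)) * integral {y..1} (\<lambda>z. cos (of_real z * w) * \<phi> z)))"
    by (intro entire_family_mult[OF _ entire_family_add] entire_family_mult[OF entire_family_cos]
        entire_family_mult[OF entire_family_mult[OF _ entire_family_sin]]
        entire_family_integral_from entire_family_mult[OF entire_family_sin] lin)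
      (intro entire_family_const continuous_intros assms)+
qed

lemma holomorphic_Delta:
  assumes "continuous_on {0..1} K"
  shows "Delta K holomorphic_on S"
  using entire_family_integral_holomorphic[OF entire_family_Delta[OF assms]]
  by (simp add: Delta_def[abs_def])

lemma holomorphic_zeta_plus:
  assumes "continuous_on {0..1} K" "continuous_on {0..1} \<phi>"
  shows "zeta_plus K \<phi> holomorphic_on S"
  unfolding zeta_plus_def[abs_def]
  by (intro holomorphic_intros entire_family_integral_holomorphic[OF entire_family_zeta_plus1[OF assms]]
      entire_family_integral_holomorphic[OF entire_family_zeta_plus2[OF assms]])

lemma holomorphic_zeta_minus:
  assumes "continuous_on {0..1} K" "continuous_on {0..1} \<phi>"
  shows "zeta_minus K \<phi> holomorphic_on S"
  unfolding zeta_minus_def[abs_def]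
  by (intro holomorphic_intros entire_family_integral_holomorphic[OF entire_family_zeta_minus[OF assms]])

lemma norm_integral_subinterval_le:
  fixes g :: "real \<Rightarrow> complex"
  assumes "continuous_on {a..b} g" "0 \<le> a" "a \<le> b" "b \<le> 1" "B \<ge> 0"
    and "\<And>z. z \<in> {a..b} \<Longrightarrow> norm (g z) \<le> B"
  shows "norm (integral {a..b} g) \<le> B"
proof -
  have "norm (integral {a..b} g) \<le> B * (b - a)"
    by (rule integral_bound) (use assms in auto)
  also have "\<dots> \<le> B"
    using assms by (intro mult_left_le) auto
  finally show ?thesis .
qed

text \<open>
  In the first term of \<open>zeta_plus\<close> the factors grow exponentially in \<open>\<bar>Im w\<bar>\<close> at rates \<open>1 - y\<close> and
  at most \<open>y\<close>, in the second one at rates \<open>y\<close> and at most \<open>1 - y\<close>.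
\<close>
lemma zeta_plus_upper_bound:
  assumes K: "continuous_on {0..1} K" and \<phi>: "continuous_on {0..1} \<phi>"
  obtains C where "C \<ge> 0" "\<And>w. norm (zeta_plus K \<phi> w) \<le> C * exp \<bar>Im w\<bar>"
proof -
  obtain A where A: "A \<ge> 0" "\<And>y. y \<in> {0..1} \<Longrightarrow> norm (K y) \<le> A"
    using continuous_on_unit_bounded[OF K] by blast
  obtain B where B: "B \<ge> 0" "\<And>y. y \<in> {0..1} \<Longrightarrow> norm (\<phi> y) \<le> B"
    using continuous_on_unit_bounded[OF \<phi>] by blast
  have "norm (zeta_plus K \<phi> w) \<le> 2 * A * B * exp \<bar>Im w\<bar>" for w
  proof -
    define t where "t = \<bar>Im w\<bar>"
    have t: "t \<ge> 0" by (simp add: t_def)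
    have cos_le: "norm (cos (of_real (1 - y) * w)) \<le> exp ((1 - y) * t)" if "y \<in> {0..1}" for y
      using norm_cos_le_exp_Im[of "of_real (1 - y) * w"] that by (simp add: abs_mult t_def)
    have exp_le: "norm (exp (- \<i> * w * of_real z)) \<le> exp (z * t)" if "z \<in> {0..1}" for z
      using that by (auto simp: t_def mult.commute intro!: mult_left_mono)
    have "norm (integral {0..1} (\<lambda>y. of_real (K y) * cos (of_real (1 - y) * w) *
       integral {0..y} (\<lambda>z. exp (- \<i> * w * of_real z) * \<phi> z))) \<le> A * B * exp t"
    proof (rule norm_integral_subinterval_le)
      fix y :: real assume y: "y \<in> {0..1}"
      have "norm (integral {0..y} (\<lambda>z. exp (- \<i> * w * of_real z) * \<phi> z)) \<le> exp (y * t) * B"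
      proof (rule norm_integral_subinterval_le)
        fix z assume z: "z \<in> {0..y}"
        have "norm (exp (- \<i> * w * of_real z)) \<le> exp (z * t)"
          using exp_le z y by auto
        also have "\<dots> \<le> exp (y * t)" using z t by (auto intro!: mult_right_mono)
        finally show "norm (exp (- \<i> * w * of_real z) * \<phi> z) \<le> exp (y * t) * B"
          unfolding norm_mult using B y z by (intro mult_mono) auto
      qed (use y B in \<open>auto intro!: continuous_intros continuous_on_subset[OF \<phi>]\<close>)
      then have "norm (of_real (K y) * cos (of_real (1 - y) * w) *
         integral {0..y} (\<lambda>z. exp (- \<i> * w * of_real z) * \<phi> z)) \<le> A * exp ((1 - y) * t) * (exp (y * t) * B)"
        unfolding norm_mult using A y cos_le[OF y] by (intro mult_mono) auto
      also have "\<dots> = A * B * (exp ((1 - y) * t) * exp (y * t))" by simp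
      also have "\<dots> = A * B * exp t" by (simp flip: exp_add add: algebra_simps)
      finally show "norm (of_real (K y) * cos (of_real (1 - y) * w) *
         integral {0..y} (\<lambda>z. exp (- \<i> * w * of_real z) * \<phi> z)) \<le> A * B * exp t" .
    qed (use A B entire_family_continuous_on[OF entire_family_zeta_plus1[OF K \<phi>]] in auto)
    moreover have "norm (integral {0..1} (\<lambda>y. of_real (K y) * exp (- \<i> * w * of_real y) *
       integral {y..1} (\<lambda>z. cos (of_real (1 - z) * w) * \<phi> z))) \<le> A * B * exp t"
    proof (rule norm_integral_subinterval_le)
      fix y :: real assume y: "y \<in> {0..1}"
      have "norm (integral {y..1} (\<lambda>z. cos (of_real (1 - z) * w) * \<phi> z)) \<le> exp ((1 - y) * t) * B"
      proof (rule norm_integral_subinterval_le)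
        fix z assume z: "z \<in> {y..1}"
        have "norm (cos (of_real (1 - z) * w)) \<le> exp ((1 - z) * t)"
          using cos_le z y by auto
        also have "\<dots> \<le> exp ((1 - y) * t)" using z t by (auto intro!: mult_right_mono)
        finally show "norm (cos (of_real (1 - z) * w) * \<phi> z) \<le> exp ((1 - y) * t) * B"
          unfolding norm_mult using B y z by (intro mult_mono) auto
      qed (use y B in \<open>auto intro!: continuous_intros continuous_on_subset[OF \<phi>]\<close>)
      then have "norm (of_real (K y) * exp (- \<i> * w * of_real y) *
         integral {y..1} (\<lambda>z. cos (of_real (1 - z) * w) * \<phi> z)) \<le> A * exp (y * t) * (exp ((1 - y) * t) * B)"
        unfolding norm_mult using A y exp_le[OF y] by (intro mult_mono) (auto simp: norm_mult)
      also have "\<dots> = A * B * (exp ((1 - y) * t) * exp (y * t))" by simp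
      also have "\<dots> = A * B * exp t" by (simp flip: exp_add add: algebra_simps)
      finally show "norm (of_real (K y) * exp (- \<i> * w * of_real y) *
         integral {y..1} (\<lambda>z. cos (of_real (1 - z) * w) * \<phi> z)) \<le> A * B * exp t" .
    qed (use A B entire_family_continuous_on[OF entire_family_zeta_plus2[OF K \<phi>]] in auto)
    ultimately show ?thesis
      unfolding zeta_plus_def t_def[symmetric] by (intro norm_triangle_le) linarith
  qed
  then show ?thesis using A B by (intro that[of "2 * A * B"]) auto
qed

lemma zeta_minus_upper_bound:
  assumes K: "continuous_on {0..1} K" and \<phi>: "continuous_on {0..1} \<phi>"
  obtains C where "C \<ge> 0" "\<And>w. norm (zeta_minus K \<phi> w) \<le> C * exp \<bar>Im w\<bar>"
proof -
  obtain A where A: "A \<ge> 0" "\<And>y. y \<in> {0..1} \<Longrightarrow> norm (K y) \<le> A"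
    using continuous_on_unit_bounded[OF K] by blast
  obtain B where B: "B \<ge> 0" "\<And>y. y \<in> {0..1} \<Longrightarrow> norm (\<phi> y) \<le> B"
    using continuous_on_unit_bounded[OF \<phi>] by blast
  have "norm (zeta_minus K \<phi> w) \<le> A * B * exp \<bar>Im w\<bar>" for w
  proof -
    define t where "t = \<bar>Im w\<bar>"
    have t: "t \<ge> 0" by (simp add: t_def)
    have "norm (integral {0..1} (\<lambda>y. of_real (K y) *
       integral {y..1} (\<lambda>z. sin (of_real (z - y) * w) * \<phi> z))) \<le> A * B * exp t"
    proof (rule norm_integral_subinterval_le)
      fix y :: real assume y: "y \<in> {0..1}"
      have "norm (integral {y..1} (\<lambda>z. sin (of_real (z - y) * w) * \<phi> z)) \<le> exp t * B"
      proof (rule norm_integral_subinterval_le)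
        fix z assume z: "z \<in> {y..1}"
        have "norm (sin (of_real (z - y) * w)) \<le> exp ((z - y) * t)"
          using norm_sin_le_exp_Im[of "of_real (z - y) * w"] z by (simp add: abs_mult t_def)
        also have "\<dots> \<le> exp t" using y z t by (auto intro!: mult_left_le_one_le)
        finally show "norm (sin (of_real (z - y) * w) * \<phi> z) \<le> exp t * B"
          unfolding norm_mult using B y z by (intro mult_mono) auto
      qed (use y B in \<open>auto intro!: continuous_intros continuous_on_subset[OF \<phi>]\<close>)
      then have "norm (of_real (K y) *
         integral {y..1} (\<lambda>z. sin (of_real (z - y) * w) * \<phi> z)) \<le> A * (exp t * B)"
        unfolding norm_mult using A y by (intro mult_mono) auto
      then show "norm (of_real (K y) *
         integral {y..1} (\<lambda>z. sin (of_real (z - y) * w) * \<phi> z)) \<le> A * B * exp t"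
        by (simp add: algebra_simps)
    qed (use A B entire_family_continuous_on[OF entire_family_zeta_minus[OF K \<phi>]] in auto)
    then show ?thesis
      unfolding zeta_minus_def t_def[symmetric] by (simp add: norm_mult)
  qed
  then show ?thesis using A B by (intro that[of "A * B"]) auto
qed

section \<open>Fourier inversion at an interior point\<close>

lemma integral_exp_symmetric:
  assumes "N > 0"
  shows "integral {-N..N} (\<lambda>l. exp (\<i> * of_real l * of_real u)) = of_real (2 * N * sinc (N * u))"
proof (cases "u = 0")
  case False
  define E where "E l = exp (\<i> * of_real u * of_real l) / (\<i> * of_real u)" for l :: real
  have "(E has_vector_derivative exp (\<i> * of_real l * of_real u)) (at l within {-N..N})" for l
  proof -
    have "((\<lambda>z. exp (\<i> * of_real u * z) / (\<i> * of_real u)) has_field_derivative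
        exp (\<i> * of_real l * of_real u)) (at (of_real l))"
      using False by (auto intro!: derivative_eq_intros simp: algebra_simps)
    from has_vector_derivative_real_field[OF this] show ?thesis
      by (simp add: E_def[abs_def])
  qed
  then have "integral {-N..N} (\<lambda>l. exp (\<i> * of_real l * of_real u)) = E N - E (-N)"
    using assms by (intro integral_unique Henstock_Kurzweil_Integration.fundamental_theorem_of_calculus) auto
  also have "\<dots> = (exp (\<i> * of_real (N * u)) - exp (- (\<i> * of_real (N * u)))) / (\<i> * of_real u)"
    by (simp add: E_def diff_divide_distrib mult_ac)
  also have "\<dots> = 2 * sin (of_real (N * u)) / of_real u"
  proof -
    have cancel_2: "a / (c * v) = 2 * (a / (2 * c)) / v" for a c v :: complex
      by simp
    show ?thesis unfolding sin_exp_eq by (rule cancel_2)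
  qed
  also have "\<dots> = of_real (2 * N * sinc (N * u))"
    using False assms by (simp flip: sin_of_real)
  finally show ?thesis .
qed (use assms in \<open>simp add: scaleR_conv_of_real\<close>)

lemma fourier_partial_integral_eq_Dirichlet:
  fixes \<phi> :: "real \<Rightarrow> complex"
  assumes \<phi>: "continuous_on {0..1} \<phi>" and N: "N > 0"
  shows "integral {-N..N} (\<lambda>l. exp (\<i> * of_real l * of_real x) *
            integral {0..1} (\<lambda>y. exp (- \<i> * of_real l * of_real y) * \<phi> y)) =
         integral {0..1} (\<lambda>y. of_real (2 * N * sinc (N * (x - y))) * \<phi> y)"
proof -
  have "integral {-N..N} (\<lambda>l. exp (\<i> * of_real l * of_real x) *
            integral {0..1} (\<lambda>y. exp (- \<i> * of_real l * of_real y) * \<phi> y)) =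
        integral {-N..N} (\<lambda>l. integral {0..1} (\<lambda>y. exp (\<i> * of_real l * of_real (x - y)) * \<phi> y))"
  proof (rule integral_cong)
    fix l
    have "exp (\<i> * of_real l * of_real x) * (exp (- \<i> * of_real l * of_real y) * \<phi> y) =
        exp (\<i> * of_real l * of_real (x - y)) * \<phi> y" for y
    proof -
      have "exp (\<i> * of_real l * of_real x) * exp (- \<i> * of_real l * of_real y) =
          exp (\<i> * of_real l * of_real (x - y))"
        by (simp flip: exp_add add: algebra_simps)
      then show ?thesis by (simp only: mult.assoc[symmetric])
    qed
    then show "exp (\<i> * of_real l * of_real x) *
            integral {0..1} (\<lambda>y. exp (- \<i> * of_real l * of_real y) * \<phi> y) =
       integral {0..1} (\<lambda>y. exp (\<i> * of_real l * of_real (x - y)) * \<phi> y)"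
      unfolding integral_mult_right[symmetric] by (simp only:)
  qed
  also have "\<dots> = integral {0..1} (\<lambda>y. integral {-N..N} (\<lambda>l. exp (\<i> * of_real l * of_real (x - y)) * \<phi> y))"
  proof -
    have "continuous_on (cbox (-N, 0) (N, 1)) (\<lambda>(l :: real, y). exp (\<i> * of_real l * of_real (x - y)) * \<phi> y)"
      unfolding case_prod_unfold
      by (intro continuous_intros continuous_on_compose2[OF \<phi>]) (auto simp flip: cbox_Pair_eq)
    from integral_swap_continuous[OF this] show ?thesis by simp
  qed
  also have "\<dots> = integral {0..1} (\<lambda>y. of_real (2 * N * sinc (N * (x - y))) * \<phi> y)"
    unfolding integral_mult_left integral_exp_symmetric[OF N] ..
  finally show ?thesis .
qed

text \<open>
  The function \<open>y \<mapsto> - 2 * Si (N * (x - y))\<close> is a primitive of the Dirichlet kernel. Unlike the kernel,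
  it stays bounded as \<open>N\<close> grows, which is why the derivative is moved to \<open>\<phi>\<close>.
\<close>
lemma Dirichlet_integral_by_parts:
  fixes \<phi> \<phi>' :: "real \<Rightarrow> complex"
  assumes cont: "continuous_on {0..1} \<phi>'"
    and deriv: "\<And>y. y \<in> {0..1} \<Longrightarrow> (\<phi> has_vector_derivative \<phi>' y) (at y within {0..1})"
  shows "integral {0..1} (\<lambda>y. of_real (2 * N * sinc (N * (x - y))) * \<phi> y) =
    2 * (of_real (Si (N * x)) * \<phi> 0 - of_real (Si (N * (x - 1))) * \<phi> 1
         + integral {0..1} (\<lambda>y. of_real (Si (N * (x - y))) * \<phi>' y))"
proof -
  have \<phi>: "continuous_on {0..1} \<phi>"
    using deriv by (meson continuous_on_vector_derivative)
  have Si: "continuous_on UNIV Si"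
    by (simp add: continuous_at_imp_continuous_on isCont_Si)
  define f where "f y = of_real (- 2 * Si (N * (x - y))) * \<phi> y" for y
  have "(f has_vector_derivative of_real (2 * N * sinc (N * (x - y))) * \<phi> y
      - 2 * (of_real (Si (N * (x - y))) * \<phi>' y)) (at y within {0..1})" if "y \<in> {0..1}" for y
  proof -
    have "((\<lambda>y. Si (N * (x - y))) has_real_derivative sinc (N * (x - y)) * (- N)) (at y within {0..1})"
      by (rule DERIV_chain2[OF DERIV_Si]) (auto intro!: derivative_eq_intros)
    from DERIV_cmult[OF this, of "-2"]
    have "((\<lambda>y. - 2 * Si (N * (x - y))) has_real_derivative 2 * N * sinc (N * (x - y))) (at y within {0..1})"
      by (simp add: mult_ac split del: if_split)
    from has_vector_derivative_mult[OF has_vector_derivative_of_real[OF this] deriv[OF that]]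
    show ?thesis
      unfolding f_def by (simp add: algebra_simps split del: if_split)
  qed
  then have "f 1 - f 0 = integral {0..1} (\<lambda>y. of_real (2 * N * sinc (N * (x - y))) * \<phi> y
      - 2 * (of_real (Si (N * (x - y))) * \<phi>' y))"
    by (intro integral_unique[symmetric] Henstock_Kurzweil_Integration.fundamental_theorem_of_calculus) auto
  also have "\<dots> = integral {0..1} (\<lambda>y. of_real (2 * N * sinc (N * (x - y))) * \<phi> y)
      - integral {0..1} (\<lambda>y. 2 * (of_real (Si (N * (x - y))) * \<phi>' y))"
    by (intro integral_diff integrable_continuous_interval continuous_intros
        continuous_on_compose2[OF Si] \<phi> cont) auto
  finally have parts: "f 1 - f 0 = integral {0..1} (\<lambda>y. of_real (2 * N * sinc (N * (x - y))) * \<phi> y)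
      - 2 * integral {0..1} (\<lambda>y. of_real (Si (N * (x - y))) * \<phi>' y)"
    unfolding integral_mult_right .
  have "d = 2 * (of_real (Si (N * x)) * \<phi> 0 - of_real (Si (N * (x - 1))) * \<phi> 1 + j)"
    if "f 1 - f 0 = d - 2 * j" for d j
    using that by (simp add: f_def algebra_simps)
  from this[OF parts] show ?thesis .
qed

lemma Si_at_bot: "(Si \<longlongrightarrow> - (pi / 2)) at_bot"
proof -
  have "((\<lambda>t. - Si t) \<longlongrightarrow> - (pi / 2)) at_top"
    by (intro tendsto_minus Si_at_top)
  moreover have "\<forall>\<^sub>F t in at_top. - Si t = Si (- t)"
    using eventually_ge_at_top[of 0] by eventually_elim (simp add: Si_neg)
  ultimately have "((\<lambda>t. Si (- t)) \<longlongrightarrow> - (pi / 2)) at_top"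
    by (rule Lim_transform_eventually)
  then show ?thesis
    by (simp add: filterlim_at_bot_mirror)
qed

lemma tendsto_Si_scaled: "((\<lambda>N. Si (N * u)) \<longlongrightarrow> pi / 2 * sgn u) at_top"
proof -
  consider "u > 0" | "u = 0" | "u < 0" by linarith
  then show ?thesis
  proof cases
    case 1
    then have "filterlim (\<lambda>N. N * u) at_top at_top"
      by real_asymp
    from filterlim_compose[OF Si_at_top this] 1 show ?thesis by simp
  next
    case 2
    then show ?thesis using Si_neg[of 0] by simp
  next
    case 3
    then have "filterlim (\<lambda>N. N * u) at_bot at_top"
      by real_asymp
    from filterlim_compose[OF Si_at_bot this] 3 show ?thesis by simp
  qed
qed

text \<open>
  The limit, as \<open>N\<close> grows, of the remaining integral in \<open>Dirichlet_integral_by_parts\<close>. Together with the limits of its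
  boundary terms, the values of \<open>\<phi>\<close> at the end points cancel.
\<close>
lemma integral_sgn_times_derivative:
  fixes \<phi> \<phi>' :: "real \<Rightarrow> complex"
  assumes deriv: "\<And>y. y \<in> {0..1} \<Longrightarrow> (\<phi> has_vector_derivative \<phi>' y) (at y within {0..1})"
    and x: "x \<in> {0..1}"
  shows "integral {0..1} (\<lambda>y. of_real (pi / 2 * sgn (x - y)) * \<phi>' y) = of_real (pi / 2) * (2 * \<phi> x - \<phi> 0 - \<phi> 1)"
proof -
  have 1: "((\<lambda>y. of_real (pi / 2 * sgn (x - y)) * \<phi>' y) has_integral of_real (pi / 2) * (\<phi> x - \<phi> 0)) {0..x}"
  proof (rule has_integral_spike_finite[of "{x}"])
    show "((\<lambda>y. of_real (pi / 2) * \<phi>' y) has_integral of_real (pi / 2) * (\<phi> x - \<phi> 0)) {0..x}"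
      by (intro has_integral_mult_right Henstock_Kurzweil_Integration.fundamental_theorem_of_calculus
          has_vector_derivative_within_subset[OF deriv]) (use x in auto)
  qed auto
  have 2: "((\<lambda>y. of_real (pi / 2 * sgn (x - y)) * \<phi>' y) has_integral of_real (- (pi / 2)) * (\<phi> 1 - \<phi> x)) {x..1}"
  proof (rule has_integral_spike_finite[of "{x}"])
    show "((\<lambda>y. of_real (- (pi / 2)) * \<phi>' y) has_integral of_real (- (pi / 2)) * (\<phi> 1 - \<phi> x)) {x..1}"
      by (intro has_integral_mult_right Henstock_Kurzweil_Integration.fundamental_theorem_of_calculus
          has_vector_derivative_within_subset[OF deriv]) (use x in auto)
  qed auto
  have "integral {0..1} (\<lambda>y. of_real (pi / 2 * sgn (x - y)) * \<phi>' y) =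
      of_real (pi / 2) * (\<phi> x - \<phi> 0) + of_real (- (pi / 2)) * (\<phi> 1 - \<phi> x)"
    using x by (intro integral_unique has_integral_combine[OF _ _ 1 2]) auto
  also have "\<dots> = of_real (pi / 2) * (2 * \<phi> x - \<phi> 0 - \<phi> 1)"
  proof -
    have "p * (X - A) + (- p) * (B - X) = p * (2 * X - A - B)" for p X A B :: complex
      by (simp add: algebra_simps)
    then show ?thesis unfolding of_real_minus by blast
  qed
  finally show ?thesis .
qed

lemma tendsto_Dirichlet_integral:
  fixes \<phi> :: "real \<Rightarrow> complex"
  assumes "C1_unit \<phi>" "x \<in> {0<..<1}"
  shows "((\<lambda>N. integral {0..1} (\<lambda>y. of_real (2 * N * sinc (N * (x - y))) * \<phi> y)) \<longlongrightarrow> 2 * of_real pi * \<phi> x) at_top"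
proof -
  obtain \<phi>' where cont: "continuous_on {0..1} \<phi>'"
    and deriv: "\<And>y. y \<in> {0..1} \<Longrightarrow> (\<phi> has_vector_derivative \<phi>' y) (at y within {0..1})"
    using assms(1) unfolding C1_unit_def by blast
  have Si: "continuous_on UNIV Si"
    by (simp add: continuous_at_imp_continuous_on isCont_Si)
  obtain B where B: "\<And>T. \<bar>Si T\<bar> \<le> B"
    using bounded_Si by blast
  have lim: "((\<lambda>N. integral {0..1} (\<lambda>y. of_real (Si (N * (x - y))) * \<phi>' y)) \<longlongrightarrow>
      integral {0..1} (\<lambda>y. of_real (pi / 2 * sgn (x - y)) * \<phi>' y)) at_top"
  proof (rule tendsto_at_topI_sequentially)
    fix X :: "nat \<Rightarrow> real" assume X: "filterlim X at_top sequentially"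
    show "(\<lambda>n. integral {0..1} (\<lambda>y. of_real (Si (X n * (x - y))) * \<phi>' y)) \<longlonglongrightarrow>
      integral {0..1} (\<lambda>y. of_real (pi / 2 * sgn (x - y)) * \<phi>' y)"
    proof (rule Equivalence_Lebesgue_Henstock_Integration.dominated_convergence(2)[where h = "\<lambda>y. B * norm (\<phi>' y)"])
      show "(\<lambda>y. of_real (Si (X k * (x - y))) * \<phi>' y) integrable_on {0..1}" for k
        by (intro integrable_continuous_interval continuous_intros
          continuous_on_compose2[OF Si] cont) auto
      show "(\<lambda>y. B * norm (\<phi>' y)) integrable_on {0..1}"
        by (intro integrable_continuous_interval continuous_intros cont)
      show "(\<lambda>k. of_real (Si (X k * (x - y))) * \<phi>' y) \<longlonglongrightarrow> of_real (pi / 2 * sgn (x - y)) * \<phi>' y" for y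
        by (intro tendsto_intros filterlim_compose[OF tendsto_Si_scaled X])
      show "norm (of_real (Si (X k * (x - y))) * \<phi>' y) \<le> B * norm (\<phi>' y)" for k y
        unfolding norm_mult using B by (intro mult_right_mono) auto
    qed
  qed
  have "((\<lambda>N. 2 * (of_real (Si (N * x)) * \<phi> 0 - of_real (Si (N * (x - 1))) * \<phi> 1
         + integral {0..1} (\<lambda>y. of_real (Si (N * (x - y))) * \<phi>' y))) \<longlongrightarrow>
      2 * (of_real (pi / 2 * sgn x) * \<phi> 0 - of_real (pi / 2 * sgn (x - 1)) * \<phi> 1
         + integral {0..1} (\<lambda>y. of_real (pi / 2 * sgn (x - y)) * \<phi>' y))) at_top"
    by (intro tendsto_intros tendsto_Si_scaled lim)
  moreover have "2 * (of_real (pi / 2 * sgn x) * \<phi> 0 - of_real (pi / 2 * sgn (x - 1)) * \<phi> 1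
         + integral {0..1} (\<lambda>y. of_real (pi / 2 * sgn (x - y)) * \<phi>' y)) = 2 * of_real pi * \<phi> x"
  proof -
    have "integral {0..1} (\<lambda>y. of_real (pi / 2 * sgn (x - y)) * \<phi>' y)
        = of_real (pi / 2) * (2 * \<phi> x - \<phi> 0 - \<phi> 1)"
      by (rule integral_sgn_times_derivative[OF deriv]) (use assms(2) in auto)
    moreover have "sgn x = 1" "sgn (x - 1) = - 1"
      using assms(2) by auto
    ultimately show ?thesis
      by (simp only:) (simp add: field_simps)
  qed
  moreover have "integral {0..1} (\<lambda>y. of_real (2 * N * sinc (N * (x - y))) * \<phi> y) =
      2 * (of_real (Si (N * x)) * \<phi> 0 - of_real (Si (N * (x - 1))) * \<phi> 1
         + integral {0..1} (\<lambda>y. of_real (Si (N * (x - y))) * \<phi>' y))" for N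
    by (rule Dirichlet_integral_by_parts[OF cont]) (rule deriv)
  ultimately show ?thesis
    by (simp only:)
qed

lemma real_line_inversion:
  fixes \<phi> :: "real \<Rightarrow> complex"
  assumes \<phi>: "C1_unit \<phi>" and x: "x \<in> {0<..<1}"
    and f: "\<And>w. w \<in> \<real> \<Longrightarrow> f w = integral {0..1} (\<lambda>y. exp (- \<i> * w * of_real y) * \<phi> y)"
  shows "improper_integrable real_path (\<lambda>w. exp (\<i> * w * of_real x) * f w)"
    and "improper_integral real_path (\<lambda>w. exp (\<i> * w * of_real x) * f w) = 2 * of_real pi * \<phi> x"
proof -
  define g where "g w = exp (\<i> * w * of_real x) * integral {0..1} (\<lambda>y. exp (- \<i> * w * of_real y) * \<phi> y)" for w
  have \<phi>c: "continuous_on {0..1} \<phi>"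
    using \<phi> by (rule C1_unit_continuous_on)
  have "entire_family (\<lambda>w y. exp (- \<i> * w * of_real y) * \<phi> y)"
    by (intro entire_family_mult[OF entire_family_exp] 
      entire_family_mult[OF entire_family_mult[OF _ entire_family_id]])
      (intro entire_family_const continuous_intros \<phi>c)+
  then have "g holomorphic_on UNIV"
    unfolding g_def[abs_def] by (intro holomorphic_intros entire_family_integral_holomorphic)
  then have g: "continuous_on S g" for S
    by (meson holomorphic_on_imp_continuous_on holomorphic_on_subset subset_UNIV)
  have int: "((\<lambda>w. exp (\<i> * w * of_real x) * f w) has_contour_integral
      integral {0..1} (\<lambda>y. of_real (2 * N * sinc (N * (x - y))) * \<phi> y)) (real_path N)" if N: "N > 0" for N
  proof (rule has_contour_integral_eq)
    have "g contour_integrable_on real_path N"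
      unfolding real_path_def by (intro contour_integrable_continuous_linepath g)
    moreover have "contour_integral (real_path N) g = integral {-N..N} (\<lambda>l. g (of_real l))"
      unfolding real_path_def using N by (subst contour_integral_linepath_Reals_eq) auto
    moreover have "integral {-N..N} (\<lambda>l. g (of_real l)) =
        integral {0..1} (\<lambda>y. of_real (2 * N * sinc (N * (x - y))) * \<phi> y)"
      unfolding g_def by (rule fourier_partial_integral_eq_Dirichlet[OF \<phi>c N])
    ultimately show "(g has_contour_integral
        integral {0..1} (\<lambda>y. of_real (2 * N * sinc (N * (x - y))) * \<phi> y)) (real_path N)"
      using has_contour_integral_integral[of g "real_path N"] by (simp only:)
    fix w assume "w \<in> path_image (real_path N)"
    then have "w \<in> \<real>"
      by (auto simp: real_path_def closed_segment_def scaleR_conv_of_real simp flip: of_real_minus)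
    then show "g w = exp (\<i> * w * of_real x) * f w"
      by (simp add: g_def f)
  qed
  have ev: "\<forall>\<^sub>F N in at_top. (0::real) < N" by (rule eventually_gt_at_top)
  have lim: "((\<lambda>N. contour_integral (real_path N) (\<lambda>w. exp (\<i> * w * of_real x) * f w)) \<longlongrightarrow>
      2 * of_real pi * \<phi> x) at_top"
    by (rule Lim_transform_eventually[OF tendsto_Dirichlet_integral[OF \<phi> x]])
      (use ev in eventually_elim, rule contour_integral_unique[OF int, symmetric])
  show "improper_integrable real_path (\<lambda>w. exp (\<i> * w * of_real x) * f w)"
    unfolding improper_integrable_def
  proof (intro conjI exI[of _ "2 * of_real pi * \<phi> x"] lim)
    show "\<forall>\<^sub>F N in at_top. (\<lambda>w. exp (\<i> * w * of_real x) * f w) contour_integrable_on real_path N"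
      using ev by eventually_elim (use int in \<open>unfold contour_integrable_on_def, blast\<close>)
  qed
  show "improper_integral real_path (\<lambda>w. exp (\<i> * w * of_real x) * f w) = 2 * of_real pi * \<phi> x"
    unfolding improper_integral_def using lim by (intro tendsto_Lim) auto
qed

section \<open>Integrals over the sector contours\<close>

lemma cmod_le_sqrt2_Im:
  assumes "\<bar>Re w\<bar> \<le> Im w"
  shows "cmod w \<le> sqrt 2 * Im w"
proof -
  have "(Re w)\<^sup>2 \<le> (Im w)\<^sup>2"
    using assms by (simp add: abs_le_square_iff[symmetric])
  then have "cmod w \<le> sqrt (2 * (Im w)\<^sup>2)"
    unfolding cmod_def by (intro real_sqrt_le_mono) linarith
  also have "\<dots> = sqrt 2 * Im w"
    using assms by (simp add: real_sqrt_mult)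
  finally show ?thesis .
qed

lemma Re_square_neg_iff: "Re (w\<^sup>2) < 0 \<longleftrightarrow> \<bar>Re w\<bar> < \<bar>Im w\<bar>"
proof -
  have "Re (w\<^sup>2) = (Re w)\<^sup>2 - (Im w)\<^sup>2"
    by (simp add: power2_eq_square)
  then show ?thesis
    using abs_le_square_iff[of "Im w" "Re w"] by linarith
qed

lemma add_i_in_D_plus:
  assumes "0 < Im w" "\<bar>Re w\<bar> \<le> Im w" "\<rho> \<le> cmod w" "t > 0"
  shows "w + \<i> * of_real t \<in> D_plus \<rho>"
proof -
  have "(Im w)\<^sup>2 < (Im w + t)\<^sup>2"
    using assms by (intro power_strict_mono) auto
  then have "cmod w < cmod (w + \<i> * of_real t)"
    unfolding cmod_def by simp
  then show ?thesis
    using assms unfolding D_plus_def mem_Collect_eq Re_square_neg_iff by auto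
qed

text \<open>
  Moving such a point upwards by any amount leads into the region, so the point lies in its
  closure; it is not in the region, where both inequalities are strict.
\<close>
lemma frontier_D_plusI:
  assumes "0 < Im w" "\<bar>Re w\<bar> \<le> Im w" "\<rho> \<le> cmod w" "\<bar>Re w\<bar> = Im w \<or> cmod w = \<rho>"
  shows "w \<in> frontier (D_plus \<rho>)"
proof -
  have "w \<in> closure (D_plus \<rho>)"
    unfolding closure_approachable
  proof (intro allI impI)
    fix e :: real assume "e > 0"
    then show "\<exists>y\<in>D_plus \<rho>. dist y w < e"
      using add_i_in_D_plus[OF assms(1-3), of "e / 2"]
      by (intro bexI[of _ "w + \<i> * of_real (e / 2)"]) (auto simp: dist_norm norm_mult)
  qed
  moreover have "w \<notin> D_plus \<rho>"
    using assms unfolding D_plus_def mem_Collect_eq Re_square_neg_iff by auto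
  ultimately show ?thesis
    unfolding frontier_def using interior_subset by blast
qed

lemma D_minus_eq: "D_minus \<rho> = uminus ` D_plus \<rho>"
  by (force simp: D_minus_def D_plus_def image_iff intro: exI[of _ "- _"])

lemma uminus_frontier_D_plus:
  assumes "w \<in> frontier (D_plus \<rho>)"
  shows "- w \<in> frontier (D_minus \<rho>)"
proof -
  have "- w \<in> closure (uminus ` D_plus \<rho>)"
    using assms closure_linear_image_subset[of uminus "D_plus \<rho>"]
    by (auto simp: frontier_def linear_uminus)
  moreover have "- w \<notin> interior (uminus ` D_plus \<rho>)"
    using assms by (auto simp: frontier_def interior_negations)
  ultimately show ?thesis
    by (simp add: frontier_def D_minus_eq)
qed

lemma Im_frontier_D_plus_nonneg:
  assumes "w \<in> frontier (D_plus \<rho>)"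
  shows "0 \<le> Im w"
proof -
  have "closure (D_plus \<rho>) \<subseteq> {z. 0 \<le> Im z}"
    by (rule closure_minimal) (auto simp: D_plus_def closed_halfspace_Im_ge)
  then show ?thesis
    using assms by (auto simp: frontier_def)
qed

lemma cis_pi_4: "cis (pi / 4) = Complex (sqrt 2 / 2) (sqrt 2 / 2)"
  by (simp add: complex_eq_iff sin_45 cos_45)

lemma cis_3pi_4: "cis (3 * pi / 4) = Complex (- (sqrt 2 / 2)) (sqrt 2 / 2)"
proof -
  have eq: "3 * pi / 4 = pi - pi / 4" by simp
  show ?thesis
    unfolding eq by (simp only: complex_eq_iff cis.sel complex.sel cos_pi_minus sin_pi_minus sin_45 cos_45 simp_thms)
qed

lemma valid_path_plus_path: "valid_path (plus_path \<rho> N)"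
  and pathstart_plus_path: "pathstart (plus_path \<rho> N) = of_real N * cis (3 * pi / 4)"
  and pathfinish_plus_path: "pathfinish (plus_path \<rho> N) = of_real N * cis (pi / 4)"
  unfolding plus_path_def by (auto intro!: valid_path_join simp: cis_conv_exp)

lemma abs_cos_le_sin:
  assumes "pi / 4 \<le> \<theta>" "\<theta> \<le> 3 * pi / 4"
  shows "\<bar>cos \<theta>\<bar> \<le> sin \<theta>"
proof -
  have "0 \<le> sin (\<theta> - pi / 4)" "0 \<le> sin (\<theta> + pi / 4)"
    using assms by (auto intro!: sin_ge_zero)
  then have "0 \<le> (sin \<theta> - cos \<theta>) * (sqrt 2 / 2)" "0 \<le> (sin \<theta> + cos \<theta>) * (sqrt 2 / 2)"
    by (simp_all add: sin_diff sin_add sin_45 cos_45 algebra_simps)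
  then show ?thesis
    by (simp add: zero_le_mult_iff abs_le_iff)
qed

lemma closed_segment_ray:
  fixes c :: complex
  assumes "w \<in> closed_segment (of_real a * c) (of_real b * c)"
  obtains r where "r \<in> closed_segment a b" "w = of_real r * c"
proof -
  obtain u where "0 \<le> u" "u \<le> 1" "w = (1 - u) *\<^sub>R (of_real a * c) + u *\<^sub>R (of_real b * c)"
    using assms by (auto simp: in_segment)
  then show ?thesis
    by (intro that[of "(1 - u) * a + u * b"])
      (auto simp: in_segment scaleR_conv_of_real algebra_simps)
qed

lemma plus_path_image:
  assumes "0 < \<rho>" "\<rho> \<le> N" "w \<in> path_image (plus_path \<rho> N)"
  shows "0 < Im w" "\<bar>Re w\<bar> \<le> Im w" "\<rho> \<le> cmod w" "\<bar>Re w\<bar> = Im w \<or> cmod w = \<rho>"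
proof -
  have "w \<in> closed_segment (of_real N * cis (3 * pi / 4)) (of_real \<rho> * cis (3 * pi / 4)) \<or>
     w \<in> path_image (part_circlepath 0 \<rho> (3 * pi / 4) (pi / 4)) \<or>
     w \<in> closed_segment (of_real \<rho> * cis (pi / 4)) (of_real N * cis (pi / 4))"
    using assms(3) unfolding plus_path_def
    by (auto dest!: subsetD[OF path_image_join_subset])
  then obtain r \<theta> where w: "w = of_real r * cis \<theta>" and r: "\<rho> \<le> r"
    and \<theta>: "\<theta> = pi / 4 \<or> \<theta> = 3 * pi / 4 \<or> r = \<rho> \<and> pi / 4 \<le> \<theta> \<and> \<theta> \<le> 3 * pi / 4"
  proof (elim disjE)
    assume "w \<in> closed_segment (of_real N * cis (3 * pi / 4)) (of_real \<rho> * cis (3 * pi / 4))"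
    then obtain r where "r \<in> closed_segment N \<rho>" "w = of_real r * cis (3 * pi / 4)"
      by (rule closed_segment_ray)
    then show ?thesis
      using assms(2) by (intro that[of r "3 * pi / 4"]) (auto simp: closed_segment_eq_real_ivl split: if_splits)
  next
    assume "w \<in> closed_segment (of_real \<rho> * cis (pi / 4)) (of_real N * cis (pi / 4))"
    then obtain r where "r \<in> closed_segment \<rho> N" "w = of_real r * cis (pi / 4)"
      by (rule closed_segment_ray)
    then show ?thesis
      using assms(2) by (intro that[of r "pi / 4"]) (auto simp: closed_segment_eq_real_ivl split: if_splits)
  next
    assume "w \<in> path_image (part_circlepath 0 \<rho> (3 * pi / 4) (pi / 4))"
    then obtain \<theta> where "\<theta> \<in> closed_segment (3 * pi / 4) (pi / 4)" "w = of_real \<rho> * cis \<theta>"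
      unfolding path_image_part_circlepath' by auto
    then show ?thesis
      using that[of \<rho> \<theta>] pi_gt_zero by (auto simp: closed_segment_eq_real_ivl split: if_splits)
  qed
  have rpos: "0 < r" using assms(1) r by linarith
  have ReIm: "Re w = r * cos \<theta>" "Im w = r * sin \<theta>" "cmod w = r"
    using rpos by (auto simp: w norm_mult)
  have \<theta>_ge: "pi / 4 \<le> \<theta>" and \<theta>_le: "\<theta> \<le> 3 * pi / 4"
    using \<theta> pi_gt_zero by auto
  have "\<bar>cos \<theta>\<bar> \<le> sin \<theta>"
    using \<theta>_ge \<theta>_le by (rule abs_cos_le_sin)
  moreover have "0 < \<theta>" "\<theta> < pi"
    using \<theta>_ge \<theta>_le pi_gt_zero by linarith+
  then have "0 < sin \<theta>"
    by (rule sin_gt_zero)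
  ultimately show "0 < Im w" "\<bar>Re w\<bar> \<le> Im w" "\<rho> \<le> cmod w"
    using rpos r by (auto simp: ReIm abs_mult)
  have "\<bar>cos (pi / 4)\<bar> = sin (pi / 4)" "\<bar>cos (3 * pi / 4)\<bar> = sin (3 * pi / 4)"
    using cis_3pi_4 by (simp_all add: complex_eq_iff cos_45 sin_45)
  with \<theta> have "\<bar>cos \<theta>\<bar> = sin \<theta> \<or> r = \<rho>"
    by (elim disjE conjE) (simp_all only: simp_thms)
  then show "\<bar>Re w\<bar> = Im w \<or> cmod w = \<rho>"
    using rpos by (auto simp: ReIm abs_mult)
qed

lemma minus_path_eq: "minus_path \<rho> N = uminus \<circ> plus_path \<rho> N"
proof -
  have lin: "uminus \<circ> linepath a b = linepath (- a) (- b)" for a b :: complex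
    by (auto simp: fun_eq_iff linepath_def algebra_simps)
  have 1: "- cis (3 * pi / 4) = cis (- pi / 4)" "- cis (pi / 4) = cis (- 3 * pi / 4)"
    unfolding minus_cis' by (rule arg_cong[of _ _ cis], simp)+
  have "- part_circlepath 0 \<rho> (3 * pi / 4) (pi / 4) t = part_circlepath 0 \<rho> (- pi / 4) (- 3 * pi / 4) t" for t
  proof -
    have "linepath (- pi / 4) (- 3 * pi / 4) t = linepath (3 * pi / 4) (pi / 4) t - pi"
      by (simp add: linepath_def field_simps)
    then show ?thesis
      unfolding part_circlepath_def cis_conv_exp[symmetric] by (simp flip: minus_cis')
  qed
  then have "uminus \<circ> part_circlepath 0 \<rho> (3 * pi / 4) (pi / 4) = part_circlepath 0 \<rho> (- pi / 4) (- 3 * pi / 4)"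
    by auto
  then show ?thesis
    unfolding plus_path_def minus_path_def path_compose_join lin by (simp only: 1 flip: mult_minus_right)
qed

text \<open>
  With \<open>s = sqrt 2 / 2\<close>, the bound for the integral over the closing segment at height \<open>N * s\<close>: a bound
  for the integrand times a bound for the length.
\<close>
lemma tendsto_square_times_exp_neg:
  fixes s c C :: real
  assumes "0 < s" "0 < c"
  shows "((\<lambda>N. C * (N * s) * exp (- c * (N * s)) * (2 * N)) \<longlongrightarrow> 0) at_top"
proof -
  have "((\<lambda>N. (N * s) * exp (- c * (N * s)) * (2 * N)) \<longlongrightarrow> 0) at_top"
    using assms by real_asymp
  from tendsto_mult_right_zero[OF this, of C] show ?thesis
    by (simp only: mult.assoc)
qed

text \<open>
  Since \<open>g\<close> is holomorphic on the convex half plane that contains the contour, Cauchy's theorem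
  moves the integral to the horizontal segment between the end points of the contour. Its points have
  imaginary part \<open>N / sqrt 2\<close> and lie in the closed sector, so the exponential bound applies to all of them.
  The functions \<open>f\<close> and \<open>g\<close> are kept apart because the transform is defined piecewise and agrees
  with a holomorphic function only on the contour.
\<close>
lemma plus_path_integral_vanishes:
  fixes f g :: "complex \<Rightarrow> complex"
  assumes \<rho>: "0 < \<rho>"
    and hol: "g holomorphic_on {w. \<rho> / sqrt 2 \<le> Im w}"
    and eq: "\<And>w. w \<in> frontier (D_plus \<rho>) \<Longrightarrow> 0 < Im w \<Longrightarrow> f w = g w"
    and c: "0 < c" "0 \<le> C"
    and bound: "\<And>w. R \<le> Im w \<Longrightarrow> cmod w \<le> sqrt 2 * Im w \<Longrightarrow> norm (g w) \<le> C * Im w * exp (- c * Im w)"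
  shows "\<forall>\<^sub>F N in at_top. f contour_integrable_on plus_path \<rho> N"
    and "((\<lambda>N. contour_integral (plus_path \<rho> N) f) \<longlongrightarrow> 0) at_top"
proof -
  let ?H = "{w. \<rho> / sqrt 2 \<le> Im w}"
  define B where "B N = C * (N * (sqrt 2 / 2)) * exp (- c * (N * (sqrt 2 / 2)))" for N
  have main: "f contour_integrable_on plus_path \<rho> N \<and>
      norm (contour_integral (plus_path \<rho> N) f) \<le> B N * (2 * N)"
    if N: "\<rho> \<le> N" "R \<le> N * (sqrt 2 / 2)" for N
  proof -
    define a where "a = of_real N * cis (pi / 4)"
    define b where "b = of_real N * cis (3 * pi / 4)"
    \<comment> \<open>the height of the closing segment\<close>
    define h where "h = N * (sqrt 2 / 2)"
    have h: "0 \<le> h"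
      using N \<rho> by (simp add: h_def)
    have ab: "a = Complex h h" "b = Complex (- h) h"
      by (simp_all add: a_def b_def h_def cis_pi_4 cis_3pi_4 complex_eq_iff)
    have seg: "Im w = h \<and> \<bar>Re w\<bar> \<le> Im w" if w: "w \<in> closed_segment a b" for w
    proof -
      from w have "\<exists>u. 0 \<le> u \<and> u \<le> 1 \<and> w = (1 - u) *\<^sub>R a + u *\<^sub>R b"
        unfolding in_segment by simp
      then obtain u where u: "0 \<le> u" "u \<le> 1" "w = (1 - u) *\<^sub>R a + u *\<^sub>R b"
        by (elim exE conjE) (rule that)
      have "Im w = h" "Re w = (1 - 2 * u) * h"
        unfolding u(3) ab by (simp_all add: algebra_simps)
      moreover have "\<bar>1 - 2 * u\<bar> * h \<le> 1 * h"
        using u(1,2) h by (intro mult_right_mono) auto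
      ultimately show ?thesis
        using h by (simp add: abs_mult)
    qed
    have "\<rho> / sqrt 2 = \<rho> * (sqrt 2 / 2)"
      by (simp add: nonzero_divide_eq_eq)
    also have "\<dots> \<le> h"
      unfolding h_def using N by (intro mult_right_mono) auto
    finally have \<rho>_le: "\<rho> / sqrt 2 \<le> h" .
    have seg_sub: "closed_segment a b \<subseteq> ?H"
    proof (rule subsetI)
      fix w assume "w \<in> closed_segment a b"
      from conjunct1[OF seg[OF this]] \<rho>_le show "w \<in> ?H"
        unfolding mem_Collect_eq by (simp only:)
    qed
    have path_sub: "path_image (plus_path \<rho> N) \<subseteq> ?H"
    proof
      fix w assume w: "w \<in> path_image (plus_path \<rho> N)"
      have "\<rho> \<le> sqrt 2 * Im w"
        using plus_path_image[OF \<rho> N(1) w] cmod_le_sqrt2_Im[of w] by linarith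
      then show "w \<in> ?H"
        by (simp add: pos_divide_le_eq mult.commute)
    qed
    have loop: "(g has_contour_integral 0) (plus_path \<rho> N +++ linepath a b)"
    proof (rule Cauchy_theorem_convex_simple[OF hol])
      show "path_image (plus_path \<rho> N +++ linepath a b) \<subseteq> ?H"
        using path_sub seg_sub by (intro subset_path_image_join) auto
    qed (auto intro!: valid_path_join valid_path_plus_path convex_halfspace_Im_ge
         simp: pathstart_plus_path pathfinish_plus_path a_def b_def)
    have "g contour_integrable_on (plus_path \<rho> N +++ linepath a b)"
      using loop unfolding contour_integrable_on_def by (rule exI)
    then have g1: "g contour_integrable_on plus_path \<rho> N"
      by (rule contour_integrable_joinD1[OF _ valid_path_plus_path])
    have g2: "g contour_integrable_on linepath a b"
      by (intro contour_integrable_continuous_linepath continuous_on_subset[OF holomorphic_on_imp_continuous_on[OF hol]] seg_sub)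
    have "contour_integral (plus_path \<rho> N) g + contour_integral (linepath a b) g = 0"
      using contour_integral_unique[OF loop] contour_integral_join[OF g1 g2 valid_path_plus_path] by simp
    then have "norm (contour_integral (plus_path \<rho> N) g) = norm (contour_integral (linepath a b) g)"
      by (simp add: add_eq_0_iff2)
    also have "\<dots> \<le> B N * norm (b - a)"
    proof (rule contour_integral_bound_linepath[OF g2])
      show "0 \<le> B N"
        using N \<rho> c by (simp add: B_def)
      show "norm (g w) \<le> B N" if "w \<in> closed_segment a b" for w
      proof -
        have w: "Im w = h" "cmod w \<le> sqrt 2 * Im w"
          by (rule conjunct1[OF seg[OF that]], rule cmod_le_sqrt2_Im[OF conjunct2[OF seg[OF that]]])
        have "norm (g w) \<le> C * Im w * exp (- c * Im w)"
          by (rule bound[OF _ w(2)]) (simp only: w(1) h_def N(2))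
        then show ?thesis
          by (simp only: w(1) B_def h_def)
      qed
    qed
    also have "\<dots> \<le> B N * (2 * N)"
    proof (rule mult_left_mono)
      show "norm (b - a) \<le> 2 * N"
        using norm_triangle_ineq4[of b a] N \<rho> by (simp add: a_def b_def norm_mult)
      show "0 \<le> B N"
        using N \<rho> c by (simp add: B_def)
    qed
    finally have g_bound: "norm (contour_integral (plus_path \<rho> N) g) \<le> B N * (2 * N)" .
    have f_eq: "g w = f w" if "w \<in> path_image (plus_path \<rho> N)" for w
      by (rule eq[symmetric]) (intro frontier_D_plusI plus_path_image[OF \<rho> N(1) that])+
    have f_int: "(f has_contour_integral contour_integral (plus_path \<rho> N) g) (plus_path \<rho> N)"
      by (rule has_contour_integral_eq[OF has_contour_integral_integral[OF g1]]) (rule f_eq)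
    show ?thesis
      unfolding contour_integral_unique[OF f_int] contour_integrable_on_def
      by (intro conjI exI[of _ "contour_integral (plus_path \<rho> N) g"] f_int g_bound)
  qed
  have ev: "\<forall>\<^sub>F N in at_top. \<rho> \<le> N \<and> R \<le> N * (sqrt 2 / 2)"
  proof (rule eventually_conj)
    show "\<forall>\<^sub>F N in at_top. R \<le> N * (sqrt 2 / 2)"
      using eventually_ge_at_top[of "R / (sqrt 2 / 2)"]
      by eventually_elim (simp add: pos_divide_le_eq)
  qed (rule eventually_ge_at_top)
  show "\<forall>\<^sub>F N in at_top. f contour_integrable_on plus_path \<rho> N"
    using ev by eventually_elim (use main in blast)
  have "((\<lambda>N. B N * (2 * N)) \<longlongrightarrow> 0) at_top"
    unfolding B_def using c(1) by (intro tendsto_square_times_exp_neg) simp_all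
  moreover have "\<forall>\<^sub>F N in at_top. norm (contour_integral (plus_path \<rho> N) f) \<le> B N * (2 * N)"
    using ev by eventually_elim (use main in blast)
  ultimately show "((\<lambda>N. contour_integral (plus_path \<rho> N) f) \<longlongrightarrow> 0) at_top"
    by (rule Lim_null_comparison[rotated])
qed

text \<open>
  The lower contour is the image of the upper one under negation, which changes only the sign of the
  integral.
\<close>
lemma minus_path_integral_vanishes:
  assumes "\<forall>\<^sub>F N in at_top. (\<lambda>w. f (- w)) contour_integrable_on plus_path \<rho> N"
    and "((\<lambda>N. contour_integral (plus_path \<rho> N) (\<lambda>w. f (- w))) \<longlongrightarrow> 0) at_top"
  shows "\<forall>\<^sub>F N in at_top. f contour_integrable_on minus_path \<rho> N"
    and "((\<lambda>N. contour_integral (minus_path \<rho> N) f) \<longlongrightarrow> 0) at_top"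
proof -
  have int: "(f has_contour_integral - contour_integral (plus_path \<rho> N) (\<lambda>w. f (- w))) (minus_path \<rho> N)"
    if "(\<lambda>w. f (- w)) contour_integrable_on plus_path \<rho> N" for N
    unfolding minus_path_eq
    by (rule has_contour_integral_negatepath[OF valid_path_plus_path])
      (use has_contour_integral_integral[OF that] in simp)
  show "\<forall>\<^sub>F N in at_top. f contour_integrable_on minus_path \<rho> N"
    using assms(1) by eventually_elim (use int contour_integrable_on_def in blast)
  have "((\<lambda>N. - contour_integral (plus_path \<rho> N) (\<lambda>w. f (- w))) \<longlongrightarrow> 0) at_top"
    using tendsto_minus[OF assms(2)] by simp
  moreover have "\<forall>\<^sub>F N in at_top. - contour_integral (plus_path \<rho> N) (\<lambda>w. f (- w)) = contour_integral (minus_path \<rho> N) f"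
    using assms(1) by eventually_elim (rule contour_integral_unique[OF int, symmetric])
  ultimately show "((\<lambda>N. contour_integral (minus_path \<rho> N) f) \<longlongrightarrow> 0) at_top"
    by (rule Lim_transform_eventually)
qed

section \<open>Linearity\<close>

lemma integral_mult_lincomb:
  fixes e u v :: "real \<Rightarrow> complex"
  assumes "(\<lambda>z. e z * u z) integrable_on S" "(\<lambda>z. e z * v z) integrable_on S"
  shows "integral S (\<lambda>z. e z * (a * u z + b * v z)) =
    a * integral S (\<lambda>z. e z * u z) + b * integral S (\<lambda>z. e z * v z)"
proof -
  have "integral S (\<lambda>z. e z * (a * u z + b * v z)) = integral S (\<lambda>z. a * (e z * u z) + b * (e z * v z))"
    by (simp add: algebra_simps)
  also have "\<dots> = integral S (\<lambda>z. a * (e z * u z)) + integral S (\<lambda>z. b * (e z * v z))"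
    by (intro Henstock_Kurzweil_Integration.integral_add integrable_on_mult_right assms)
  finally show ?thesis by simp
qed

lemma zeta_plus_lincomb:
  assumes K: "continuous_on {0..1} K" and \<phi>: "continuous_on {0..1} \<phi>" and \<psi>: "continuous_on {0..1} \<psi>"
  shows "zeta_plus K (\<lambda>y. a * \<phi> y + b * \<psi> y) w = a * zeta_plus K \<phi> w + b * zeta_plus K \<psi> w"
proof -
  have inner: "integral {c..d} (\<lambda>z. e z * (a * \<phi> z + b * \<psi> z)) =
      a * integral {c..d} (\<lambda>z. e z * \<phi> z) + b * integral {c..d} (\<lambda>z. e z * \<psi> z)"
    if "continuous_on UNIV e" "0 \<le> c" "d \<le> 1" for c d e
    by (intro integral_mult_lincomb integrable_continuous_interval continuous_intros
        continuous_on_subset[OF \<phi>] continuous_on_subset[OF \<psi>] continuous_on_subset[OF that(1)])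
      (use that in auto)
  have 1: "integral {0..1} (\<lambda>y. of_real (K y) * cos (of_real (1 - y) * w) *
       integral {0..y} (\<lambda>z. exp (- \<i> * w * of_real z) * (a * \<phi> z + b * \<psi> z))) =
     integral {0..1} (\<lambda>y. of_real (K y) * cos (of_real (1 - y) * w) *
       (a * integral {0..y} (\<lambda>z. exp (- \<i> * w * of_real z) * \<phi> z)
        + b * integral {0..y} (\<lambda>z. exp (- \<i> * w * of_real z) * \<psi> z)))"
    by (intro integral_cong arg_cong2[of _ _ _ _ "(*)"] refl inner) (auto intro!: continuous_intros)
  have 2: "integral {0..1} (\<lambda>y. of_real (K y) * exp (- \<i> * w * of_real y) *
       integral {y..1} (\<lambda>z. cos (of_real (1 - z) * w) * (a * \<phi> z + b * \<psi> z))) =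
     integral {0..1} (\<lambda>y. of_real (K y) * exp (- \<i> * w * of_real y) *
       (a * integral {y..1} (\<lambda>z. cos (of_real (1 - z) * w) * \<phi> z)
        + b * integral {y..1} (\<lambda>z. cos (of_real (1 - z) * w) * \<psi> z)))"
    by (intro integral_cong arg_cong2[of _ _ _ _ "(*)"] refl inner) (auto intro!: continuous_intros)
  show ?thesis
    unfolding zeta_plus_def 1 2
    by (subst (1 2) integral_mult_lincomb)
      (intro integrable_continuous_interval entire_family_continuous_on
        entire_family_zeta_plus1[OF K] entire_family_zeta_plus2[OF K] \<phi> \<psi> | simp add: algebra_simps)+
qed

lemma zeta_minus_lincomb:
  assumes K: "continuous_on {0..1} K" and \<phi>: "continuous_on {0..1} \<phi>" and \<psi>: "continuous_on {0..1} \<psi>"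
  shows "zeta_minus K (\<lambda>y. a * \<phi> y + b * \<psi> y) w = a * zeta_minus K \<phi> w + b * zeta_minus K \<psi> w"
proof -
  have 1: "integral {0..1} (\<lambda>y. of_real (K y) *
       integral {y..1} (\<lambda>z. sin (of_real (z - y) * w) * (a * \<phi> z + b * \<psi> z))) =
     integral {0..1} (\<lambda>y. of_real (K y) *
       (a * integral {y..1} (\<lambda>z. sin (of_real (z - y) * w) * \<phi> z)
        + b * integral {y..1} (\<lambda>z. sin (of_real (z - y) * w) * \<psi> z)))"
    by (intro integral_cong arg_cong2[of _ _ _ _ "(*)"] refl integral_mult_lincomb
        integrable_continuous_interval continuous_intros
        continuous_on_subset[OF \<phi>] continuous_on_subset[OF \<psi>]) auto
  show ?thesis
    unfolding zeta_minus_def 1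
    by (subst integral_mult_lincomb)
      (intro integrable_continuous_interval entire_family_continuous_on
        entire_family_zeta_minus[OF K] \<phi> \<psi> | simp add: algebra_simps)+
qed

lemma F_transform_lincomb:
  assumes K: "continuous_on {0..1} K" and \<phi>: "continuous_on {0..1} \<phi>" and \<psi>: "continuous_on {0..1} \<psi>"
  shows "F_transform K \<rho> (\<lambda>y. a * \<phi> y + b * \<psi> y) w =
    a * F_transform K \<rho> \<phi> w + b * F_transform K \<rho> \<psi> w"
proof -
  have "integral {0..1} (\<lambda>y. exp (- \<i> * w * of_real y) * (a * \<phi> y + b * \<psi> y)) =
    a * integral {0..1} (\<lambda>y. exp (- \<i> * w * of_real y) * \<phi> y)
    + b * integral {0..1} (\<lambda>y. exp (- \<i> * w * of_real y) * \<psi> y)"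
    by (intro integral_mult_lincomb integrable_continuous_interval continuous_intros \<phi> \<psi>)
  then show ?thesis
    unfolding F_transform_def zeta_plus_lincomb[OF assms] zeta_minus_lincomb[OF assms]
    by (simp add: algebra_simps add_divide_distrib diff_divide_distrib)
qed

lemma improper_integral_lincomb:
  assumes f: "improper_integrable \<gamma> f" and g: "improper_integrable \<gamma> g"
  shows "improper_integrable \<gamma> (\<lambda>w. a * f w + b * g w)"
    and "improper_integral \<gamma> (\<lambda>w. a * f w + b * g w) = a * improper_integral \<gamma> f + b * improper_integral \<gamma> g"
proof -
  obtain I where I: "((\<lambda>N. contour_integral (\<gamma> N) f) \<longlongrightarrow> I) at_top"
    using f by (auto simp: improper_integrable_def)
  obtain J where J: "((\<lambda>N. contour_integral (\<gamma> N) g) \<longlongrightarrow> J) at_top"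
    using g by (auto simp: improper_integrable_def)
  have ev: "\<forall>\<^sub>F N in at_top. f contour_integrable_on \<gamma> N \<and> g contour_integrable_on \<gamma> N"
    using f g by (auto simp: improper_integrable_def intro: eventually_conj)
  have "\<forall>\<^sub>F N in at_top. a * contour_integral (\<gamma> N) f + b * contour_integral (\<gamma> N) g =
      contour_integral (\<gamma> N) (\<lambda>w. a * f w + b * g w)"
    using ev by eventually_elim
      (simp add: contour_integral_add contour_integral_lmul contour_integrable_lmul)
  moreover have "((\<lambda>N. a * contour_integral (\<gamma> N) f + b * contour_integral (\<gamma> N) g) \<longlongrightarrow> a * I + b * J) at_top"
    by (intro tendsto_intros I J)
  ultimately have lim: "((\<lambda>N. contour_integral (\<gamma> N) (\<lambda>w. a * f w + b * g w)) \<longlongrightarrow> a * I + b * J) at_top"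
    by (rule Lim_transform_eventually[rotated])
  have "\<forall>\<^sub>F N in at_top. (\<lambda>w. a * f w + b * g w) contour_integrable_on \<gamma> N"
    using ev by eventually_elim (simp add: contour_integrable_add contour_integrable_lmul)
  then show "improper_integrable \<gamma> (\<lambda>w. a * f w + b * g w)"
    unfolding improper_integrable_def using lim by blast
  show "improper_integral \<gamma> (\<lambda>w. a * f w + b * g w) = a * improper_integral \<gamma> f + b * improper_integral \<gamma> g"
    using tendsto_Lim[OF _ lim] tendsto_Lim[OF _ I] tendsto_Lim[OF _ J]
    by (simp add: improper_integral_def)
qed

lemma Finv_lincomb:
  assumes "Finv_exists \<rho> f x" "Finv_exists \<rho> g x"
  shows "Finv_exists \<rho> (\<lambda>w. a * f w + b * g w) x"
    and "F_inverse \<rho> (\<lambda>w. a * f w + b * g w) x = a * F_inverse \<rho> f x + b * F_inverse \<rho> g x"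
proof -
  have eq: "(\<lambda>w. exp (\<i> * w * of_real x) * (a * f w + b * g w)) =
      (\<lambda>w. a * (exp (\<i> * w * of_real x) * f w) + b * (exp (\<i> * w * of_real x) * g w))"
    by (simp add: algebra_simps)
  have int: "improper_integrable \<gamma> (\<lambda>w. exp (\<i> * w * of_real x) * f w)"
    "improper_integrable \<gamma> (\<lambda>w. exp (\<i> * w * of_real x) * g w)"
    if "\<gamma> \<in> {real_path, plus_path \<rho>, minus_path \<rho>}" for \<gamma>
    using assms that unfolding Finv_exists_def by blast+
  show "Finv_exists \<rho> (\<lambda>w. a * f w + b * g w) x"
    unfolding Finv_exists_def eq by (intro ballI improper_integral_lincomb(1) int)
  show "F_inverse \<rho> (\<lambda>w. a * f w + b * g w) x = a * F_inverse \<rho> f x + b * F_inverse \<rho> g x"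
  proof -
    have lin: "improper_integral \<gamma> (\<lambda>w. a * (exp (\<i> * w * of_real x) * f w) + b * (exp (\<i> * w * of_real x) * g w)) =
        a * improper_integral \<gamma> (\<lambda>w. exp (\<i> * w * of_real x) * f w)
        + b * improper_integral \<gamma> (\<lambda>w. exp (\<i> * w * of_real x) * g w)"
      if "\<gamma> \<in> {real_path, plus_path \<rho>, minus_path \<rho>}" for \<gamma>
      by (intro improper_integral_lincomb(2) int that)
    show ?thesis
      unfolding F_inverse_def eq by (simp only: lin insert_iff simp_thms) (simp only: algebra_simps)
  qed
qed

section \<open>The transform pair\<close>

text \<open>
  A lower bound for \<open>w * d\<close> instead of \<open>d\<close> costs a factor \<open>norm w\<close> in the quotient, which the
  exponential decay on the contours absorbs.
\<close>
lemma norm_quotient_le: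
  fixes z d w :: complex
  assumes "0 < k" "0 < E" "k * E \<le> norm (w * d)" "norm z \<le> C * E"
  shows "norm (z / d) \<le> C / k * norm w"
proof -
  have "0 < k * E" using assms by simp
  then have pos: "0 < norm w * norm d"
    using assms(3) unfolding norm_mult by linarith
  then have d: "0 < norm d"
    by (metis mult_zero_right norm_ge_zero order_le_less)
  have C: "0 \<le> C"
    using assms(2) order_trans[OF norm_ge_zero assms(4)] by (simp add: zero_le_mult_iff)
  have "norm z * k \<le> C * E * k"
    using assms by (intro mult_right_mono) auto
  also have "\<dots> = C * (k * E)" by simp
  also have "\<dots> \<le> C * (norm w * norm d)"
    using assms(3) C unfolding norm_mult by (intro mult_left_mono) auto
  finally show ?thesis
    using d assms(1) by (simp add: norm_divide field_simps)
qed

lemma plus_contour_contribution: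
  assumes K: "C1_unit K" "K 0 \<noteq> 0" and \<rho>: "0 < \<rho>"
    and zeros: "\<And>w. Delta K w = 0 \<Longrightarrow> \<bar>Im w\<bar> < \<rho> / sqrt 2"
    and \<phi>: "continuous_on {0..1} \<phi>" and x: "0 < x"
  shows "improper_integrable (plus_path \<rho>) (\<lambda>w. exp (\<i> * w * of_real x) * F_transform K \<rho> \<phi> w)"
    and "improper_integral (plus_path \<rho>) (\<lambda>w. exp (\<i> * w * of_real x) * F_transform K \<rho> \<phi> w) = 0"
proof -
  have Kc: "continuous_on {0..1} K" using K(1) by (rule C1_unit_continuous_on)
  obtain k R where k: "k > 0" "R \<ge> 1"
    "\<And>w. \<bar>Im w\<bar> \<ge> R \<Longrightarrow> k * exp \<bar>Im w\<bar> \<le> norm (w * Delta K w)"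
    using Delta_lower_bound[OF K] by blast
  obtain C where C: "C \<ge> 0" "\<And>w. norm (zeta_plus K \<phi> w) \<le> C * exp \<bar>Im w\<bar>"
    using zeta_plus_upper_bound[OF Kc \<phi>] by blast
  let ?f = "\<lambda>w. exp (\<i> * w * of_real x) * F_transform K \<rho> \<phi> w"
  define g where "g w = exp (\<i> * w * of_real x) * (- zeta_plus K \<phi> w / Delta K w)" for w
  have hol: "g holomorphic_on {w. \<rho> / sqrt 2 \<le> Im w}"
    unfolding g_def using zeros
    by (intro holomorphic_intros holomorphic_zeta_plus[OF Kc \<phi>] holomorphic_Delta[OF Kc]) fastforce
  have eq: "?f w = g w" if "w \<in> frontier (D_plus \<rho>)" "0 < Im w" for w
    using that by (simp add: F_transform_def g_def complex_is_Real_iff)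
  have bound: "norm (g w) \<le> (C / k * sqrt 2) * Im w * exp (- x * Im w)"
    if w: "R \<le> Im w" "cmod w \<le> sqrt 2 * Im w" for w
  proof -
    have "norm (zeta_plus K \<phi> w / Delta K w) \<le> C / k * norm w"
      by (rule norm_quotient_le[OF k(1) exp_gt_zero k(3) C(2)]) (use w in auto)
    also have "\<dots> \<le> C / k * (sqrt 2 * Im w)"
      using w C k by (intro mult_left_mono) auto
    finally have "exp (- x * Im w) * norm (zeta_plus K \<phi> w / Delta K w) \<le> exp (- x * Im w) * (C / k * (sqrt 2 * Im w))"
      by (intro mult_left_mono) auto
    then show ?thesis
      unfolding g_def by (simp add: norm_mult norm_divide mult_ac)
  qed
  have Ck: "0 \<le> C / k * sqrt 2" using C k by simp
  note vanish = plus_path_integral_vanishes[OF \<rho> hol eq x Ck bound]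
  show "improper_integrable (plus_path \<rho>) ?f"
    unfolding improper_integrable_def using vanish by blast
  show "improper_integral (plus_path \<rho>) ?f = 0"
    unfolding improper_integral_def by (rule tendsto_Lim[OF _ vanish(2)]) simp_all
qed

text \<open>
  The substitution \<open>w \<mapsto> - w\<close> brings the integrand to the upper half plane. There its exponential
  factors are \<open>exp (- \<i> * w * x) * exp (\<i> * w)\<close>, of modulus \<open>exp (- (1 - x) * Im w)\<close>.
\<close>
lemma minus_contour_contribution:
  assumes K: "C1_unit K" "K 0 \<noteq> 0" and \<rho>: "0 < \<rho>"
    and zeros: "\<And>w. Delta K w = 0 \<Longrightarrow> \<bar>Im w\<bar> < \<rho> / sqrt 2"
    and \<phi>: "continuous_on {0..1} \<phi>" and x: "x < 1"
  shows "improper_integrable (minus_path \<rho>) (\<lambda>w. exp (\<i> * w * of_real x) * F_transform K \<rho> \<phi> w)"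
    and "improper_integral (minus_path \<rho>) (\<lambda>w. exp (\<i> * w * of_real x) * F_transform K \<rho> \<phi> w) = 0"
proof -
  have Kc: "continuous_on {0..1} K" using K(1) by (rule C1_unit_continuous_on)
  obtain k R where k: "k > 0" "R \<ge> 1"
    "\<And>w. \<bar>Im w\<bar> \<ge> R \<Longrightarrow> k * exp \<bar>Im w\<bar> \<le> norm (w * Delta K w)"
    using Delta_lower_bound[OF K] by blast
  obtain C where C: "C \<ge> 0" "\<And>w. norm (zeta_minus K \<phi> w) \<le> C * exp \<bar>Im w\<bar>"
    using zeta_minus_upper_bound[OF Kc \<phi>] by blast
  let ?f = "\<lambda>w. exp (\<i> * w * of_real x) * F_transform K \<rho> \<phi> w"
  define g where "g w = exp (- (\<i> * w * of_real x)) * (- exp (\<i> * w) * zeta_minus K \<phi> (- w) / Delta K (- w))" for w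
  have reflect: "(\<lambda>w. h (- w)) holomorphic_on S" if "h holomorphic_on UNIV" for h :: "complex \<Rightarrow> complex" and S
    using holomorphic_on_compose_gen[OF holomorphic_on_minus[OF holomorphic_on_ident] that subset_UNIV]
    by (simp only: o_def)
  have hol: "g holomorphic_on {w. \<rho> / sqrt 2 \<le> Im w}"
    unfolding g_def using zeros
    by (intro holomorphic_intros reflect holomorphic_zeta_minus[OF Kc \<phi>] holomorphic_Delta[OF Kc]) fastforce
  have eq: "?f (- w) = g w" if "w \<in> frontier (D_plus \<rho>)" "0 < Im w" for w
  proof -
    have "- w \<in> frontier (D_minus \<rho>)" "- w \<notin> frontier (D_plus \<rho>)" "- w \<notin> \<real>"
      using that uminus_frontier_D_plus Im_frontier_D_plus_nonneg[of "- w" \<rho>]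
      by (auto simp: complex_is_Real_iff)
    then show ?thesis by (simp add: F_transform_def g_def)
  qed
  have bound: "norm (g w) \<le> (C / k * sqrt 2) * Im w * exp (- (1 - x) * Im w)"
    if w: "R \<le> Im w" "cmod w \<le> sqrt 2 * Im w" for w
  proof -
    have "norm (zeta_minus K \<phi> (- w) / Delta K (- w)) \<le> C / k * norm (- w)"
      by (rule norm_quotient_le[OF k(1) exp_gt_zero k(3) C(2)]) (use w in auto)
    also have "\<dots> \<le> C / k * (sqrt 2 * Im w)"
      using w C k by (intro mult_left_mono) auto
    finally have "exp (- (1 - x) * Im w) * norm (zeta_minus K \<phi> (- w) / Delta K (- w))
        \<le> exp (- (1 - x) * Im w) * (C / k * (sqrt 2 * Im w))"
      by (intro mult_left_mono) auto
    moreover have "norm (g w) = exp (- (1 - x) * Im w) * norm (zeta_minus K \<phi> (- w) / Delta K (- w))"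
    proof -
      have "norm (exp (- (\<i> * w * of_real x))) * norm (exp (\<i> * w)) = exp (- (1 - x) * Im w)"
        by (simp flip: exp_add add: algebra_simps)
      then show ?thesis
        unfolding g_def by (simp only: norm_mult norm_divide norm_minus_cancel flip: times_divide_eq_right mult.assoc)
    qed
    ultimately show ?thesis
      by (simp only: mult_ac)
  qed
  have Ck: "0 \<le> C / k * sqrt 2" using C k by simp
  have x': "0 < 1 - x" using x by simp
  note vanish = minus_path_integral_vanishes[of ?f, OF plus_path_integral_vanishes[OF \<rho> hol eq x' Ck bound]]
  show "improper_integrable (minus_path \<rho>) ?f"
    unfolding improper_integrable_def using vanish by blast
  show "improper_integral (minus_path \<rho>) ?f = 0"
    unfolding improper_integral_def by (rule tendsto_Lim[OF _ vanish(2)]) simp_all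
qed

theorem proposition5:
  fixes K :: "real \<Rightarrow> real" and \<rho> :: real
  assumes K_C1: "C1_unit K"
    and K_supp: "\<exists>\<delta>>0. \<forall>y\<in>{0..1} \<inter> {0..<\<delta>}. K y \<noteq> 0"
    and rho_pos: "\<rho> > 0"
    and rho_zeros: "\<And>w. Delta K w = 0 \<Longrightarrow> \<bar>Im w\<bar> < \<rho> / sqrt 2"
  shows "(\<forall>\<phi> \<psi> :: real \<Rightarrow> complex. \<forall>a b :: complex.
            continuous_on {0..1} \<phi> \<longrightarrow> continuous_on {0..1} \<psi> \<longrightarrow>
            (\<forall>w \<in> contours \<rho>. F_transform K \<rho> (\<lambda>y. a * \<phi> y + b * \<psi> y) w =
                 a * F_transform K \<rho> \<phi> w + b * F_transform K \<rho> \<psi> w))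
       \<and> (\<forall>f g :: complex \<Rightarrow> complex. \<forall>a b :: complex. \<forall>x :: real.
            Finv_exists \<rho> f x \<longrightarrow> Finv_exists \<rho> g x \<longrightarrow>
            Finv_exists \<rho> (\<lambda>w. a * f w + b * g w) x \<and>
            F_inverse \<rho> (\<lambda>w. a * f w + b * g w) x = a * F_inverse \<rho> f x + b * F_inverse \<rho> g x)
       \<and> (\<forall>\<phi> :: real \<Rightarrow> complex. C1_unit \<phi> \<longrightarrow>
            (\<forall>x \<in> {0<..<1}. Finv_exists \<rho> (F_transform K \<rho> \<phi>) x \<and>
                 F_inverse \<rho> (F_transform K \<rho> \<phi>) x = \<phi> x))"
proof (intro conjI allI impI ballI)
  fix \<phi> \<psi> :: "real \<Rightarrow> complex" and a b w :: complex
  assume "continuous_on {0..1} \<phi>" "continuous_on {0..1} \<psi>"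
  then show "F_transform K \<rho> (\<lambda>y. a * \<phi> y + b * \<psi> y) w = a * F_transform K \<rho> \<phi> w + b * F_transform K \<rho> \<psi> w"
    by (rule F_transform_lincomb[OF C1_unit_continuous_on[OF K_C1]])
next
  fix f g :: "complex \<Rightarrow> complex" and a b :: complex and x :: real
  assume "Finv_exists \<rho> f x" "Finv_exists \<rho> g x"
  then show "Finv_exists \<rho> (\<lambda>w. a * f w + b * g w) x"
    "F_inverse \<rho> (\<lambda>w. a * f w + b * g w) x = a * F_inverse \<rho> f x + b * F_inverse \<rho> g x"
    by (rule Finv_lincomb)+
next
  fix \<phi> :: "real \<Rightarrow> complex" and x :: real
  assume \<phi>: "C1_unit \<phi>" and x: "x \<in> {0<..<1}"
  have K0: "K 0 \<noteq> 0"
    using K_supp by force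
  have \<phi>c: "continuous_on {0..1} \<phi>"
    using \<phi> by (rule C1_unit_continuous_on)
  have x01: "0 < x" "x < 1" using x by auto
  have "F_transform K \<rho> \<phi> w = integral {0..1} (\<lambda>y. exp (- \<i> * w * of_real y) * \<phi> y)"
    if "w \<in> \<real>" for w
    using that by (simp add: F_transform_def)
  note line = real_line_inversion[OF \<phi> x this]
  note plus = plus_contour_contribution[OF K_C1 K0 rho_pos rho_zeros \<phi>c x01(1)]
  note minus = minus_contour_contribution[OF K_C1 K0 rho_pos rho_zeros \<phi>c x01(2)]
  show "Finv_exists \<rho> (F_transform K \<rho> \<phi>) x"
    unfolding Finv_exists_def using line(1) plus(1) minus(1) by simp
  show "F_inverse \<rho> (F_transform K \<rho> \<phi>) x = \<phi> x"
    unfolding F_inverse_def using line(2) plus(2) minus(2) by simp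
qed

end
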